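(* Let $s\in\left(\frac14,1\right]$ and $\tau>0$ be fixed. The minimization problem $$\Gamma:=\inf_{u\in\mathcal Y_\tau}\mathcal E(u)$$ has at least one solution, that is, there exists a real-valued function $\varphi\in\mathcal Y_\tau$ such that $\mathcal E(\varphi)=\Gamma$. Moreover, there exists $\omega>0$ such that $\varphi$ satisfies $$(-\Delta)^s\varphi-\omega\varphi+\varphi^3=0.$$
   Context: All functions are $2\pi$-periodic, on $\mathbb T=[-\pi,\pi]$. The fractional Laplacian is $\widehat{(-\Delta)^s V}(\xi)=|\xi|^{2s}\widehat V(\xi)$, $\xi\in\mathbb Z$. $H^s_{per}$ is the periodic Sobolev space of real-valued functions with norm $\|f\|_{H^s_{per}}^2=2\pi\sum_{k\in\mathbb Z}(1+k^2)^s|\hat f(k)|^2$, $L^2_{per}=H^0_{per}$, and $H^s_{per,odd}$ is its subspace of odd functions. Set $$\mathcal Y_\tau=\{u\in H^s_{per,odd}:\ \|u\|_{L^2_{per}}^2=\tau\},\qquad \mathcal E(u)=\frac12\int_{-\pi}^{\pi}\big((-\Delta)^{s/2}u\big)^2+\frac12u^4\,dx.$$ *)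

theory Defs
  imports "HOL-Analysis.Analysis"
begin

text \<open>
  Functions on the torus are represented by functions on the real line that are
  \<open>2\<pi>\<close>-periodic. Elements of the function spaces are representatives of classes
  modulo equality almost everywhere.
\<close>

definition periodic_2pi :: "(real \<Rightarrow> real) \<Rightarrow> bool" where
  "periodic_2pi f \<longleftrightarrow> (\<forall>x. f (x + 2 * pi) = f x)"

definition L1_per :: "(real \<Rightarrow> real) set" where
  "L1_per = {f. periodic_2pi f \<and> f \<in> borel_measurable borel \<and> set_integrable lborel {-pi..pi} f}"

text \<open>
  The normalisation \<open>1 / (2\<pi>)\<close> is the one for which Parseval's identity reads
  \<open>\<integral> |f|\<^sup>2 = 2\<pi> \<Sum> |f^(k)|\<^sup>2\<close>, matching the factor \<open>2\<pi>\<close> in the Sobolev norm.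
\<close>

definition fourier_coeff :: "(real \<Rightarrow> real) \<Rightarrow> int \<Rightarrow> complex" where
  "fourier_coeff f k =
     (LINT x:{-pi..pi}|lborel. complex_of_real (f x) * exp (- \<i> * of_int k * complex_of_real x))
       / complex_of_real (2 * pi)"

text \<open>
  Intended for exponents \<open>s \<ge> 0\<close>, where every element is square integrable.
\<close>

definition Hs_per :: "real \<Rightarrow> (real \<Rightarrow> real) set" where
  "Hs_per s = {f. periodic_2pi f \<and> f \<in> borel_measurable borel
     \<and> set_integrable lborel {-pi..pi} (\<lambda>x. (f x)\<^sup>2)
     \<and> (\<lambda>k::int. (1 + (real_of_int k)\<^sup>2) powr s * (cmod (fourier_coeff f k))\<^sup>2) summable_on UNIV}"

definition Hs_norm :: "real \<Rightarrow> (real \<Rightarrow> real) \<Rightarrow> real" where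
  "Hs_norm s f =
     sqrt (2 * pi * (\<Sum>\<^sub>\<infinity>k::int. (1 + (real_of_int k)\<^sup>2) powr s * (cmod (fourier_coeff f k))\<^sup>2))"

abbreviation L2_norm_per :: "(real \<Rightarrow> real) \<Rightarrow> real" where
  "L2_norm_per \<equiv> Hs_norm 0"

definition Hs_per_odd :: "real \<Rightarrow> (real \<Rightarrow> real) set" where
  "Hs_per_odd s = {f \<in> Hs_per s. AE x in lborel. f (- x) = - f x}"

text \<open>
  \<open>W\<close> is the function \<open>(-\<Delta>)\<^sup>s V\<close>: an integrable periodic function, hence unique up to null
  sets, whose Fourier coefficients are the prescribed ones. Intended for \<open>s > 0\<close>; the zero
  mode is annihilated since \<open>0 powr a = 0\<close>.
\<close>

definition has_frac_laplacian :: "real \<Rightarrow> (real \<Rightarrow> real) \<Rightarrow> (real \<Rightarrow> real) \<Rightarrow> bool" where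
  "has_frac_laplacian s V W \<longleftrightarrow> V \<in> L1_per \<and> W \<in> L1_per \<and>
     (\<forall>\<xi>::int. fourier_coeff W \<xi> =
        complex_of_real (\<bar>real_of_int \<xi>\<bar> powr (2 * s)) * fourier_coeff V \<xi>)"

text \<open>
  A representative of \<open>(-\<Delta>)\<^sup>s V\<close>, meaningful only if such a function exists. For
  \<open>V\<close> in \<open>Hs_per s\<close> with \<open>s > 0\<close>, the function \<open>frac_laplacian (s / 2) V\<close> exists and is
  square integrable by the Riesz--Fischer theorem.
\<close>

definition frac_laplacian :: "real \<Rightarrow> (real \<Rightarrow> real) \<Rightarrow> real \<Rightarrow> real" where
  "frac_laplacian s V = (SOME W. has_frac_laplacian s V W)"

definition Y_set :: "real \<Rightarrow> real \<Rightarrow> (real \<Rightarrow> real) set" where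
  "Y_set s \<tau> = {u \<in> Hs_per_odd s. (L2_norm_per u)\<^sup>2 = \<tau>}"

text \<open>
  For \<open>s > 1/4\<close> and \<open>u\<close> in \<open>Hs_per s\<close> the integrand is integrable, because \<open>Hs_per s\<close>
  embeds into \<open>L\<^sup>4\<close>.
\<close>

definition energy :: "real \<Rightarrow> (real \<Rightarrow> real) \<Rightarrow> real" where
  "energy s u =
     1/2 * (LINT x:{-pi..pi}|lborel. (frac_laplacian (s / 2) u x)\<^sup>2 + 1/2 * (u x)^4)"

end

theory Submission
  imports Defs "HOL-Complex_Analysis.Great_Picard"
begin

text \<open>
  An odd function is governed by its sine coefficients
  \<open>b\<^sub>k = (1 / \<pi>) \<integral> u(x) sin(k x) dx\<close>, and in these coordinates the constraint and the quadratic
  part of the energy are explicit: \<open>\<parallel>u\<parallel>\<^sup>2 = \<pi> \<Sum> b\<^sub>k\<^sup>2\<close> (\<open>mass\<close>) and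
  \<open>\<integral> ((-\<Delta>)\<^bsup>s/2\<^esup> u)\<^sup>2 = \<pi> \<Sum> k\<^bsup>2s\<^esup> b\<^sub>k\<^sup>2\<close> (\<open>kinetic\<close>). Only the term \<open>\<integral> u\<^sup>4\<close> (\<open>quartic\<close>) lives
  on the physical side. The passage between the two sides rests on the uniqueness of the Fourier
  coefficients of integrable functions (\<open>fourier_uniqueness\<close>) and on the Riesz--Fischer theorem
  for sine series (\<open>Riesz_Fischer_sine\<close>); together they also give Parseval's identity and identify
  \<open>frac_laplacian\<close> up to null sets.

  The hypothesis \<open>s > 1/4\<close> enters through the embedding into \<open>L\<^sup>4\<close> (\<open>Hs_embeds_L4\<close>). It makes the
  energy density integrable; the integral of a non-integrable density would be the default value \<open>0\<close>
  and spoil the infimum. For a sine polynomial \<open>p\<close> with coefficients \<open>b\<close>,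
  \<open>\<integral> p\<^sup>4\<close> is up to a constant the squared \<open>\<ell>\<^sup>2\<close> norm of a convolution of \<open>b\<close> with itself, and a
  Cauchy--Schwarz inequality with the weights \<open>w\<^sub>j = (1 + j\<^sup>2)\<^sup>s\<close> bounds it by
  \<open>(\<Sum> w\<^sub>j\<^sup>-\<^sup>2) (\<Sum> w\<^sub>j b\<^sub>j\<^sup>2)\<^sup>2\<close>. The first factor is finite because \<open>4s > 1\<close>. Fatou's lemma extends the
  bound to all of \<open>H\<^sup>s\<close>.

  A minimizer exists by the direct method (\<open>minimizer_exists\<close>). Along a minimizing sequence the
  quadratic parts are bounded, so after passing to a subsequence all sine coefficients converge.
  The bound on \<open>\<Sum> k\<^bsup>2s\<^esup> b\<^sub>k\<^sup>2\<close> makes the tails of \<open>\<Sum> b\<^sub>k\<^sup>2\<close> uniformly small, so the convergence is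
  strong in \<open>L\<^sup>2\<close> and the constraint survives in the limit. Both parts of the energy are lower
  semicontinuous by Fatou's lemma, for the series and, along an almost everywhere convergent
  subsequence, for the integral.

  For the equation, the constraint is removed by homogeneity: writing \<open>K\<close>, \<open>Q\<close>, \<open>m\<close> for \<open>kinetic\<close>,
  \<open>quartic\<close>, \<open>mass\<close>, normalising an arbitrary \<open>v\<close> to mass \<open>\<tau>\<close> shows that
  \<open>\<tau> K(v) m(v) / 2 + \<tau>\<^sup>2 Q(v) / 4 - \<Gamma> m(v)\<^sup>2\<close> is nonnegative, with equality at the minimizer
  (\<open>homogeneous_energy_inequality\<close>). Along \<open>v = \<phi> + t sin(k x)\<close> this is a polynomial in \<open>t\<close> with a
  minimum at \<open>t = 0\<close>, and the vanishing of its derivative is the \<open>k\<close>-th sine coefficient of the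
  equation with \<open>\<omega> = (K(\<phi>) + Q(\<phi>)) / \<tau>\<close>. The cosine coefficients vanish by oddness, so
  \<open>\<omega> \<phi> - \<phi>\<^sup>3\<close> has all the Fourier coefficients required of \<open>(-\<Delta>)\<^sup>s \<phi>\<close>. Finally \<open>\<omega> > 0\<close> because
  \<open>K(\<phi>) \<ge> m(\<phi>) = \<tau>\<close>: an odd function has no zero mode.
\<close>

section \<open>Fourier coefficients of integrable functions on the circle\<close>

definition circ :: "real measure" where
  "circ = restrict_space lborel {-pi..pi}"

lemma space_circ [simp]: "space circ = {-pi..pi}"
  by (simp add: circ_def space_restrict_space)

lemma measurable_circ: "f \<in> borel_measurable borel \<Longrightarrow> f \<in> borel_measurable circ"
  unfolding circ_def by (rule measurable_restrict_space1) simp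

lemma emeasure_circ: "emeasure circ {-pi..pi} = ennreal (2 * pi)"
  by (simp add: circ_def emeasure_restrict_space)

lemma finite_measure_circ: "finite_measure circ"
  by (rule finite_measureI) (simp add: emeasure_circ)

lemma integrable_circ_const [simp]: "integrable circ (\<lambda>x. c :: 'b :: {banach, second_countable_topology})"
  using finite_measure.integrable_const[OF finite_measure_circ] .

lemma set_integrable_circ:
  "set_integrable lborel {-pi..pi} f = integrable circ f"
  for f :: "real \<Rightarrow> 'b :: {banach, second_countable_topology}"
  by (simp add: circ_def set_integrable_def integrable_restrict_space)

lemma set_integral_circ:
  "(LINT x:{-pi..pi}|lborel. f x) = integral\<^sup>L circ f"
  for f :: "real \<Rightarrow> 'b :: {banach, second_countable_topology}"
  by (simp add: circ_def set_lebesgue_integral_def integral_restrict_space)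

lemma AE_circ_iff: "(AE x in circ. P x) \<longleftrightarrow> (AE x in lborel. x \<in> {-pi..pi} \<longrightarrow> P x)"
  unfolding circ_def by (rule AE_restrict_space_iff) simp

lemma AE_circI: "AE x in lborel. P x \<Longrightarrow> AE x in circ. P x"
  unfolding AE_circ_iff by auto

lemma integrable_circ_bounded_mult:
  fixes f h :: "real \<Rightarrow> real"
  assumes "integrable circ f" "h \<in> borel_measurable borel" "\<And>x. \<bar>h x\<bar> \<le> B"
  shows "integrable circ (\<lambda>x. f x * h x)"
proof (rule Bochner_Integration.integrable_bound[of circ "\<lambda>x. B * f x"])
  show "integrable circ (\<lambda>x. B * f x)" using assms(1) by simp
  show "(\<lambda>x. f x * h x) \<in> borel_measurable circ"
    using assms(1) measurable_circ[OF assms(2)] by (intro borel_measurable_times) auto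
  have "\<bar>f x\<bar> * \<bar>h x\<bar> \<le> \<bar>f x\<bar> * \<bar>B\<bar>" for x
    using assms(3)[of x] by (intro mult_left_mono) auto
  then show "AE x in circ. norm (f x * h x) \<le> norm (B * f x)"
    by (simp add: abs_mult mult.commute)
qed

lemma fourier_coeff_circ:
  assumes "integrable circ f"
  shows "fourier_coeff f k =
     Complex (integral\<^sup>L circ (\<lambda>x. f x * cos (of_int k * x)) / (2 * pi))
             (- integral\<^sup>L circ (\<lambda>x. f x * sin (of_int k * x)) / (2 * pi))"
proof -
  have c: "integrable circ (\<lambda>x. f x * cos (of_int k * x))"
    by (rule integrable_circ_bounded_mult[OF assms, where B=1]) auto
  have s: "integrable circ (\<lambda>x. f x * sin (of_int k * x))"
    by (rule integrable_circ_bounded_mult[OF assms, where B=1]) auto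
  have eq: "complex_of_real (f x) * exp (- \<i> * of_int k * complex_of_real x) =
      complex_of_real (f x * cos (of_int k * x)) - \<i> * complex_of_real (f x * sin (of_int k * x))" for x
  proof -
    have "exp (- \<i> * of_int k * complex_of_real x) = cis (- (of_int k * x))"
      by (simp add: cis_conv_exp mult.assoc)
    then show ?thesis by (simp add: complex_eq_iff)
  qed
  have "integral\<^sup>L circ (\<lambda>x. complex_of_real (f x) * exp (- \<i> * of_int k * complex_of_real x))
     = complex_of_real (integral\<^sup>L circ (\<lambda>x. f x * cos (of_int k * x)))
       - \<i> * complex_of_real (integral\<^sup>L circ (\<lambda>x. f x * sin (of_int k * x)))"
    unfolding eq using c s
    by (subst Bochner_Integration.integral_diff)
      (auto intro!: integrable_of_real simp del: of_real_mult simp: integral_complex_of_real)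
  then show ?thesis
    unfolding fourier_coeff_def set_integral_circ
    by (simp add: complex_eq_iff)
qed

text \<open>
  Asking for all frequencies, and not just for \<open>\<integral> f h = 0\<close>, makes the class stable under multiplication by
  \<open>cos\<close> and \<open>sin\<close>, hence by every trigonometric polynomial.
\<close>

definition fourier_null :: "(real \<Rightarrow> real) \<Rightarrow> (real \<Rightarrow> real) \<Rightarrow> bool" where
  "fourier_null f h \<longleftrightarrow> h \<in> borel_measurable borel \<and> (\<exists>B. \<forall>x. \<bar>h x\<bar> \<le> B) \<and>
     (\<forall>k::int. integral\<^sup>L circ (\<lambda>x. f x * h x * cos (of_int k * x)) = 0 \<and>
               integral\<^sup>L circ (\<lambda>x. f x * h x * sin (of_int k * x)) = 0)"

lemma fourier_null_integrable:
  assumes "integrable circ f" "fourier_null f h"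
  shows "integrable circ (\<lambda>x. f x * h x)"
    "integrable circ (\<lambda>x. f x * h x * cos (of_int k * x))"
    "integrable circ (\<lambda>x. f x * h x * sin (of_int k * x))"
proof -
  show *: "integrable circ (\<lambda>x. f x * h x)"
    using assms integrable_circ_bounded_mult unfolding fourier_null_def by blast
  show "integrable circ (\<lambda>x. f x * h x * cos (of_int k * x))"
       "integrable circ (\<lambda>x. f x * h x * sin (of_int k * x))"
    by (rule integrable_circ_bounded_mult[OF *, where B=1]; auto)+
qed

lemma fourier_null_add:
  assumes f: "integrable circ f" and "fourier_null f g" "fourier_null f h"
  shows "fourier_null f (\<lambda>x. g x + h x)"
proof -
  obtain B C where "\<And>x. \<bar>g x\<bar> \<le> B" "\<And>x. \<bar>h x\<bar> \<le> C"
    using assms unfolding fourier_null_def by blast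
  then have "\<bar>g x + h x\<bar> \<le> B + C" for x
    by (meson abs_triangle_ineq add_mono order_trans)
  then show ?thesis
    using assms fourier_null_integrable[OF f assms(2)] fourier_null_integrable[OF f assms(3)]
    unfolding fourier_null_def by (auto simp: distrib_left distrib_right)
qed

lemma fourier_null_scale:
  assumes "fourier_null f h"
  shows "fourier_null f (\<lambda>x. h x * c)"
proof -
  obtain B where B: "\<And>x. \<bar>h x\<bar> \<le> B" using assms unfolding fourier_null_def by blast
  have "\<bar>h x * c\<bar> \<le> B * \<bar>c\<bar>" for x
    using B[of x] by (simp add: abs_mult mult_right_mono)
  moreover have "f x * (h x * c) * y = c * (f x * h x * y)" for x y by simp
  ultimately show ?thesis
    using assms unfolding fourier_null_def by (auto simp del: mult.assoc simp: ac_simps)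
qed

lemma fourier_null_trig:
  assumes f: "integrable circ f" and h: "fourier_null f h"
  shows "fourier_null f (\<lambda>x. h x * cos x)" "fourier_null f (\<lambda>x. h x * sin x)"
proof -
  obtain B where B: "\<And>x. \<bar>h x\<bar> \<le> B" using h unfolding fourier_null_def by blast
  have bd: "\<bar>h x * y\<bar> \<le> B" if "\<bar>y\<bar> \<le> 1" for x y
    using B[of x] that mult_mono[of "\<bar>h x\<bar>" B "\<bar>y\<bar>" 1] by (simp add: abs_mult)
  have [measurable]: "h \<in> borel_measurable borel" using h unfolding fourier_null_def by blast
  note i = fourier_null_integrable(2,3)[OF f h]
  have z: "integral\<^sup>L circ (\<lambda>x. f x * h x * cos (of_int k * x)) = 0"
          "integral\<^sup>L circ (\<lambda>x. f x * h x * sin (of_int k * x)) = 0" for k :: int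
    using h unfolding fourier_null_def by auto
  have c1: "f x * (h x * cos x) * cos (of_int k * x)
     = (f x * h x * cos (of_int (k+1) * x) + f x * h x * cos (of_int (k-1) * x)) / 2" for x k
    by (simp add: algebra_simps cos_add cos_diff)
  have c2: "f x * (h x * cos x) * sin (of_int k * x)
     = (f x * h x * sin (of_int (k+1) * x) + f x * h x * sin (of_int (k-1) * x)) / 2" for x k
    by (simp add: algebra_simps sin_add sin_diff)
  have s1: "f x * (h x * sin x) * cos (of_int k * x)
     = (f x * h x * sin (of_int (k+1) * x) - f x * h x * sin (of_int (k-1) * x)) / 2" for x k
    by (simp add: algebra_simps sin_add sin_diff)
  have s2: "f x * (h x * sin x) * sin (of_int k * x)
     = (f x * h x * cos (of_int (k-1) * x) - f x * h x * cos (of_int (k+1) * x)) / 2" for x k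
    by (simp add: algebra_simps cos_add cos_diff)
  show "fourier_null f (\<lambda>x. h x * cos x)"
    unfolding fourier_null_def c1 c2 using bd
    by (auto intro!: exI[of _ B] simp: i z simp del: of_int_add of_int_diff)
  show "fourier_null f (\<lambda>x. h x * sin x)"
    unfolding fourier_null_def s1 s2 using bd
    by (auto intro!: exI[of _ B] simp: i z simp del: of_int_add of_int_diff)
qed

text \<open>
  Induction on the construction of the polynomial: with \<open>h\<close> arbitrary, a product is handled by
  multiplying with one factor after the other.
\<close>

lemma fourier_null_polynomial:
  assumes "real_polynomial_function p" and f: "integrable circ f"
  shows "fourier_null f h \<Longrightarrow> fourier_null f (\<lambda>x. h x * p (cis x))"
  using assms(1)
proof (induction arbitrary: h rule: real_polynomial_function.induct)
  case (linear p)
  have "p (cis x) = cos x * p 1 + sin x * p \<i>" for x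
  proof -
    have "cis x = cos x *\<^sub>R 1 + sin x *\<^sub>R \<i>" by (simp add: complex_eq_iff)
    then show ?thesis
      using linear(1) by (simp add: linear_add linear_scale bounded_linear.linear)
  qed
  then have eq: "(\<lambda>x. h x * p (cis x)) = (\<lambda>x. h x * cos x * p 1 + h x * sin x * p \<i>)"
    by (simp add: algebra_simps fun_eq_iff)
  show ?case unfolding eq
    by (intro fourier_null_add[OF f] fourier_null_scale fourier_null_trig[OF f] linear)
next
  case (const c)
  then show ?case by (rule fourier_null_scale)
next
  case (add p q)
  have "fourier_null f (\<lambda>x. h x * p (cis x) + h x * q (cis x))"
    by (intro fourier_null_add[OF f] add)
  then show ?case by (simp add: distrib_left)
next
  case (mult p q)
  have "fourier_null f (\<lambda>x. h x * p (cis x) * q (cis x))"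
    by (intro mult)
  then show ?case by (simp add: mult.assoc)
qed

text \<open>
  Stone--Weierstrass: continuous functions on the unit circle are uniform limits of polynomials in
  the real coordinates, and against those \<open>f\<close> integrates to zero.
\<close>

lemma integral_continuous_circle_zero:
  assumes f: "integrable circ f" and null: "fourier_null f (\<lambda>_. 1)"
    and g: "continuous_on (sphere 0 1) g"
    and gm: "(\<lambda>x. g (cis x)) \<in> borel_measurable borel"
  shows "integral\<^sup>L circ (\<lambda>x. f x * g (cis x)) = (0::real)"
proof -
  define A where "A = integral\<^sup>L circ (\<lambda>x. \<bar>f x\<bar>)"
  have A0: "0 \<le> A" unfolding A_def by simp
  have "bounded (g ` sphere 0 1)"
    by (intro compact_imp_bounded compact_continuous_image g) simp
  then obtain B where "\<forall>y \<in> g ` sphere 0 1. norm y \<le> B"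
    unfolding bounded_iff by blast
  then have B: "\<bar>g (cis x)\<bar> \<le> B" for x by simp
  have int_g: "integrable circ (\<lambda>x. f x * g (cis x))"
    by (rule integrable_circ_bounded_mult[OF f gm B])
  have *: "\<bar>integral\<^sup>L circ (\<lambda>x. f x * g (cis x))\<bar> \<le> e * A" if e: "e > 0" for e
  proof -
    obtain p where p: "real_polynomial_function p" "\<And>z. z \<in> sphere (0::complex) 1 \<Longrightarrow> \<bar>g z - p z\<bar> < e"
      using Stone_Weierstrass_real_polynomial_function[OF compact_sphere g e] by blast
    have n: "fourier_null f (\<lambda>x. p (cis x))"
      using fourier_null_polynomial[OF p(1) f null] by simp
    have int_p: "integrable circ (\<lambda>x. f x * p (cis x))"
      by (rule fourier_null_integrable(1)[OF f n])
    have "integral\<^sup>L circ (\<lambda>x. f x * p (cis x) * cos (of_int 0 * x)) = 0"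
      using n unfolding fourier_null_def by blast
    then have "integral\<^sup>L circ (\<lambda>x. f x * p (cis x)) = 0" by simp
    then have "\<bar>integral\<^sup>L circ (\<lambda>x. f x * g (cis x))\<bar>
        = \<bar>integral\<^sup>L circ (\<lambda>x. f x * g (cis x) - f x * p (cis x))\<bar>"
      using int_g int_p by simp
    also have "\<dots> \<le> integral\<^sup>L circ (\<lambda>x. \<bar>f x * g (cis x) - f x * p (cis x)\<bar>)"
      by (rule integral_abs_bound)
    also have "\<dots> \<le> integral\<^sup>L circ (\<lambda>x. e * \<bar>f x\<bar>)"
    proof (rule integral_mono)
      fix x
      have "\<bar>g (cis x) - p (cis x)\<bar> < e" by (rule p(2)) simp
      then have "\<bar>f x\<bar> * \<bar>g (cis x) - p (cis x)\<bar> \<le> \<bar>f x\<bar> * e"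
        by (intro mult_left_mono) auto
      then show "\<bar>f x * g (cis x) - f x * p (cis x)\<bar> \<le> e * \<bar>f x\<bar>"
        by (simp add: abs_mult[symmetric] right_diff_distrib mult.commute)
    qed (use f int_g int_p in auto)
    finally show ?thesis by (simp add: A_def)
  qed
  show ?thesis
  proof (rule ccontr)
    assume "integral\<^sup>L circ (\<lambda>x. f x * g (cis x)) \<noteq> 0"
    moreover define I where "I = \<bar>integral\<^sup>L circ (\<lambda>x. f x * g (cis x))\<bar>"
    ultimately have I: "I > 0" by simp
    have "I \<le> (I / (2 * (A + 1))) * A" unfolding I_def
      using *[of "I / (2 * (A + 1))"] I A0 by (simp add: I_def)
    also have "\<dots> < I" using I A0 by (simp add: field_simps add_pos_nonneg add_nonneg_pos)
    finally show False by simp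
  qed
qed

text \<open>
  The image of a closed set on the unit circle is compact, and its indicator is the pointwise limit
  of the continuous functions \<open>max 0 (1 - n d)\<close>, where \<open>d\<close> is the distance to it. The map \<open>cis\<close>
  identifies the end points \<open>-\<pi>\<close> and \<open>\<pi>\<close>, which are therefore excluded as a null set.
\<close>

lemma integral_closed_zero:
  fixes f :: "real \<Rightarrow> real"
  assumes f: "integrable circ f" and null: "fourier_null f (\<lambda>_. 1)" and C: "closed C"
  shows "integral\<^sup>L circ (\<lambda>x. f x * indicator C x) = 0"
proof (cases "C \<inter> {-pi..pi} = {}")
  case True
  then have "integral\<^sup>L circ (\<lambda>x. f x * indicator C x) = integral\<^sup>L circ (\<lambda>x. 0)"
    by (intro Bochner_Integration.integral_cong) (auto simp: indicator_def)
  then show ?thesis by simp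
next
  case False
  define K where "K = cis ` (C \<inter> {-pi..pi})"
  have K: "compact K" "K \<noteq> {}" unfolding K_def using C False
    by (auto intro!: compact_continuous_image closed_Int_compact continuous_intros)
  define g where "g n z = max 0 (1 - real n * infdist z K)" for n z
  have cont: "continuous_on S (g n)" for n S unfolding g_def by (intro continuous_intros)
  have g01: "0 \<le> g n z" "g n z \<le> 1" for n z
    by (auto simp: g_def infdist_nonneg)
  have gm: "(\<lambda>x. g n (cis x)) \<in> borel_measurable borel" for n
    by (intro borel_measurable_continuous_onI continuous_on_compose2[OF cont[of UNIV]] continuous_intros) auto
  have lim: "(\<lambda>n. g n z) \<longlonglongrightarrow> indicator K z" for z
  proof (cases "z \<in> K")
    case True then show ?thesis by (simp add: g_def)
  next
    case False
    then have "infdist z K > 0"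
      using K by (simp add: compact_imp_closed infdist_pos_not_in_closed)
    moreover obtain N where "real N > 1 / infdist z K" using reals_Archimedean2 by blast
    ultimately have "real N * infdist z K > 1" by (simp add: field_simps)
    then have "real n * infdist z K > 1" if "n \<ge> N" for n
      using that mult_right_mono[of "real N" "real n" "infdist z K"] by (simp add: infdist_nonneg)
    then have "eventually (\<lambda>n. g n z = 0) sequentially"
      by (intro eventually_sequentiallyI[of N]) (fastforce simp: g_def)
    then show ?thesis using False by (simp add: tendsto_eventually)
  qed
  have "(\<lambda>n. integral\<^sup>L circ (\<lambda>x. f x * g n (cis x))) \<longlonglongrightarrow> integral\<^sup>L circ (\<lambda>x. f x * indicator C x)"
  proof (rule integral_dominated_convergence[where w="\<lambda>x. \<bar>f x\<bar>"])
    show "(\<lambda>x. f x * indicator C x) \<in> borel_measurable circ"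
      by (rule borel_measurable_integrable[OF integrable_circ_bounded_mult[OF f
            borel_measurable_indicator[OF borel_closed[OF C]], where B=1]])
        (simp add: indicator_def)
    show "(\<lambda>x. f x * g n (cis x)) \<in> borel_measurable circ" for n
      using g01 by (intro borel_measurable_integrable[OF integrable_circ_bounded_mult[OF f gm, where B=1]]) simp
    show "AE x in circ. norm (f x * g n (cis x)) \<le> \<bar>f x\<bar>" for n
      using g01 by (intro AE_I2) (simp add: abs_mult mult_left_le)
    have "AE x in lborel. x \<noteq> pi" "AE x in lborel. x \<noteq> -pi"
      by (auto intro!: AE_lborel_singleton)
    then show "AE x in circ. (\<lambda>n. f x * g n (cis x)) \<longlonglongrightarrow> f x * indicator C x"
      unfolding AE_circ_iff
    proof eventually_elim
      case (elim x)
      show ?case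
      proof
        assume x: "x \<in> {-pi..pi}"
        with elim have x': "-pi < x" "x < pi" by auto
        have "indicator K (cis x) = (indicator C x :: real)"
        proof (cases "x \<in> C")
          case True then show ?thesis using x by (auto simp: K_def indicator_def)
        next
          case False
          have "cis x \<notin> K"
          proof
            assume "cis x \<in> K"
            then obtain y where y: "y \<in> C" "-pi \<le> y" "y \<le> pi" "cis x = cis y" by (auto simp: K_def)
            show False
            proof (cases "y = -pi")
              case True
              then have "cis x = cis pi" using y by (simp add: complex_eq_iff)
              moreover have "x \<in> {-pi<..pi}" "pi \<in> {-pi<..pi}" using x' pi_gt_zero by auto
              ultimately have "x = pi" by (metis cis_Arg_unique norm_cis greaterThanAtMost_iff cis_neq_zero sgn_cis)
              with x' show False by simp
            next
              case False
              then have "x = y" using y x' by (metis sgn_cis cis_Arg_unique less_eq_real_def)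
              with y \<open>x \<notin> C\<close> show False by simp
            qed
          qed
          with False show ?thesis by simp
        qed
        then show "(\<lambda>n. f x * g n (cis x)) \<longlonglongrightarrow> f x * indicator C x"
          using lim[of "cis x"] by (auto intro: tendsto_mult)
      qed
    qed
  qed (use f in auto)
  moreover have "integral\<^sup>L circ (\<lambda>x. f x * g n (cis x)) = 0" for n
    by (rule integral_continuous_circle_zero[OF f null cont gm])
  ultimately show ?thesis by (simp add: LIMSEQ_const_iff)
qed

text \<open>
  Sets over which \<open>f\<close> integrates to zero form a Dynkin system, and the closed sets form a generator
  of the Borel sets that is stable under intersection.
\<close>

theorem fourier_uniqueness:
  assumes f: "integrable circ f" and z: "\<And>k. fourier_coeff f k = 0"
  shows "AE x in circ. f x = 0"
proof -
  have null: "fourier_null f (\<lambda>_. 1)"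
    unfolding fourier_null_def using z[unfolded fourier_coeff_circ[OF f]]
    by (auto simp: complex_eq_iff)
  have zero: "integral\<^sup>L circ (\<lambda>x. f x * indicator A x) = 0" if "A \<in> sets borel" for A
  proof -
    have fi: "integrable circ (\<lambda>x. f x * indicator A x)" if "A \<in> sets borel" for A
      using that by (intro integrable_circ_bounded_mult[OF f, where B=1]) (auto simp: indicator_def)
    have "Int_stable (Collect (closed :: real set \<Rightarrow> bool))"
      "Collect (closed :: real set \<Rightarrow> bool) \<subseteq> Pow UNIV"
      by (auto simp: Int_stable_def)
    moreover have "A \<in> sigma_sets UNIV (Collect closed)"
      using that by (simp add: borel_eq_closed)
    ultimately show ?thesis
    proof (induction rule: sigma_sets_induct_disjoint)
      case (basic A)
      then show ?case using integral_closed_zero[OF f null] by simp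
    next
      case empty then show ?case by simp
    next
      case (compl A)
      have A: "A \<in> sets borel" using compl by (simp add: borel_eq_closed)
      have "integral\<^sup>L circ (\<lambda>x. f x * indicator UNIV x) = 0"
        by (rule integral_closed_zero[OF f null]) simp
      moreover have "f x * indicator (UNIV - A) x = f x * indicator UNIV x - f x * indicator A x" for x
        by (auto simp: indicator_def)
      ultimately show ?case using compl fi[OF A] f by simp
    next
      case (union A)
      have A: "A i \<in> sets borel" for i using union(2) by (auto simp: borel_eq_closed)
      have "(\<lambda>n. integral\<^sup>L circ (\<lambda>x. f x * indicator (\<Union>i<n. A i) x)) \<longlonglongrightarrow>
          integral\<^sup>L circ (\<lambda>x. f x * indicator (\<Union>i. A i) x)"
      proof (rule integral_dominated_convergence[where w="\<lambda>x. \<bar>f x\<bar>"])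
        have [measurable]: "(\<Union>i. A i) \<in> sets borel" "(\<Union>i<n. A i) \<in> sets borel" for n using A by auto
        show "(\<lambda>x. f x * indicator (\<Union>i. A i) x) \<in> borel_measurable circ"
          "\<And>n. (\<lambda>x. f x * indicator (\<Union>i<n. A i) x) \<in> borel_measurable circ"
          by (intro borel_measurable_integrable[OF fi]; simp)+
        show "AE x in circ. (\<lambda>n. f x * indicator (\<Union>i<n. A i) x) \<longlonglongrightarrow> f x * indicator (\<Union>i. A i) x"
          by (intro AE_I2 tendsto_mult tendsto_const LIMSEQ_indicator_UN)
      qed (use f in \<open>auto simp: indicator_def\<close>)
      moreover have "integral\<^sup>L circ (\<lambda>x. f x * indicator (\<Union>i<n. A i) x) = 0" for n
      proof -
        have "f x * indicator (\<Union>i<n. A i) x = (\<Sum>i<n. f x * indicator (A i) x)" for x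
          using union(1)
          by (subst indicator_UN_disjoint) (auto simp: sum_distrib_left disjoint_family_on_def)
        then show ?thesis using fi[OF A] union(3) by (simp only: Bochner_Integration.integral_sum) simp
      qed
      ultimately show ?case by (simp add: LIMSEQ_const_iff)
    qed
  qed
  interpret finite_measure circ by (rule finite_measure_circ)
  show ?thesis
  proof (rule density_zero[OF f])
    fix A assume "A \<in> sets circ"
    then have "A \<in> sets borel" by (auto simp: circ_def sets_restrict_space)
    from zero[OF this] show "set_lebesgue_integral circ A f = 0"
      by (simp add: set_lebesgue_integral_def mult.commute)
  qed
qed

lemma fourier_coeff_determines:
  assumes f: "integrable circ f" and g: "integrable circ g"
    and eq: "\<And>k. fourier_coeff f k = fourier_coeff g k"
  shows "AE x in circ. f x = g x"
proof -
  have *: "integrable circ (\<lambda>x. h x * cos (of_int k * x))" "integrable circ (\<lambda>x. h x * sin (of_int k * x))"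
    if "integrable circ h" for h :: "real \<Rightarrow> real" and k :: int
    by (rule integrable_circ_bounded_mult[OF that, where B=1]; auto)+
  have "fourier_coeff (\<lambda>x. f x - g x) k = 0" for k
    using eq[of k] f g *[OF f] *[OF g]
    by (simp add: fourier_coeff_circ complex_eq_iff left_diff_distrib)
  then have "AE x in circ. f x - g x = 0"
    using f g by (intro fourier_uniqueness) auto
  then show ?thesis by simp
qed

section \<open>Square integrable functions on the circle\<close>

lemma Fatou_integral:
  fixes g :: "'a \<Rightarrow> real"
  assumes h: "\<And>n. integrable M (h n)" "\<And>n x. 0 \<le> h n x"
    and g: "g \<in> borel_measurable M" "\<And>x. 0 \<le> g x"
    and lim: "AE x in M. (\<lambda>n. h n x) \<longlonglongrightarrow> g x"
    and bound: "\<And>n. integral\<^sup>L M (h n) \<le> c n" and c: "c \<longlonglongrightarrow> L"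
  shows "integrable M g" "integral\<^sup>L M g \<le> L"
proof -
  have c0: "0 \<le> c n" for n using order_trans[OF integral_nonneg_AE bound[of n]] h(2) by auto
  have L0: "0 \<le> L" by (rule LIMSEQ_le_const[OF c]) (use c0 in blast)
  have "(\<integral>\<^sup>+ x. ennreal (g x) \<partial>M) = (\<integral>\<^sup>+ x. liminf (\<lambda>n. ennreal (h n x)) \<partial>M)"
  proof (rule nn_integral_cong_AE)
    show "AE x in M. ennreal (g x) = liminf (\<lambda>n. ennreal (h n x))"
      using lim
    proof eventually_elim
      case (elim x)
      then show ?case
        by (intro lim_imp_Liminf[symmetric] tendsto_ennrealI) auto
    qed
  qed
  also have "\<dots> \<le> liminf (\<lambda>n. \<integral>\<^sup>+ x. ennreal (h n x) \<partial>M)"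
    using h(1) by (intro nn_integral_liminf) auto
  also have "\<dots> = liminf (\<lambda>n. ennreal (integral\<^sup>L M (h n)))"
    using h by (simp add: nn_integral_eq_integral)
  also have "\<dots> \<le> liminf (\<lambda>n. ennreal (c n))"
    by (intro Liminf_mono always_eventually allI ennreal_leI bound)
  also have "\<dots> = ennreal L"
    by (intro lim_imp_Liminf tendsto_ennrealI c) simp
  finally have fin: "(\<integral>\<^sup>+ x. ennreal (g x) \<partial>M) \<le> ennreal L" .
  show i: "integrable M g"
    using g fin by (intro integrableI_nonneg) (auto simp: le_less_trans)
  show "integral\<^sup>L M g \<le> L"
    using fin nn_integral_eq_integral[OF i] g L0 by (simp add: ennreal_le_iff)
qed

definition square_integrable :: "(real \<Rightarrow> real) \<Rightarrow> bool" where
  "square_integrable f \<longleftrightarrow> f \<in> borel_measurable borel \<and> integrable circ (\<lambda>x. (f x)\<^sup>2)"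

lemma square_integrableD:
  assumes "square_integrable f"
  shows "f \<in> borel_measurable borel" "f \<in> borel_measurable circ" "integrable circ (\<lambda>x. (f x)\<^sup>2)"
  using assms measurable_circ by (auto simp: square_integrable_def)

lemma square_integrable_mult:
  assumes "square_integrable f" "square_integrable g"
  shows "integrable circ (\<lambda>x. f x * g x)"
proof (rule Bochner_Integration.integrable_bound[of circ "\<lambda>x. (f x)\<^sup>2 + (g x)\<^sup>2"])
  have "\<bar>f x * g x\<bar> \<le> (f x)\<^sup>2 + (g x)\<^sup>2" for x
  proof -
    have "0 \<le> (\<bar>f x\<bar> - \<bar>g x\<bar>)\<^sup>2" by simp
    also have "\<dots> = (f x)\<^sup>2 + (g x)\<^sup>2 - 2 * \<bar>f x * g x\<bar>"
      by (simp add: power2_diff abs_mult)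
    finally show ?thesis using abs_ge_zero[of "f x * g x"] by linarith
  qed
  then show "AE x in circ. norm (f x * g x) \<le> norm ((f x)\<^sup>2 + (g x)\<^sup>2)" by simp
qed (use square_integrableD[OF assms(1)] square_integrableD[OF assms(2)] in auto)

lemma square_integrable_bounded:
  assumes "h \<in> borel_measurable borel" "\<And>x. \<bar>h x\<bar> \<le> B"
  shows "square_integrable h"
  unfolding square_integrable_def
proof
  have "integrable circ (\<lambda>x. h x * h x)"
    using assms(2) integrable_circ_bounded_mult[of "\<lambda>_. 1" h B] assms(1)
    by (intro integrable_circ_bounded_mult[OF _ assms]) simp
  then show "integrable circ (\<lambda>x. (h x)\<^sup>2)" by (simp add: power2_eq_square)
qed fact

lemma square_integrable_const [simp]: "square_integrable (\<lambda>_. c)"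
  by (rule square_integrable_bounded[of _ "\<bar>c\<bar>"]) auto

lemma square_integrable_sin [simp]: "square_integrable (\<lambda>x. sin (a * x))"
  by (rule square_integrable_bounded[of _ 1]) auto

lemma square_integrable_imp_integrable: "square_integrable f \<Longrightarrow> integrable circ f"
  using square_integrable_mult[of f "\<lambda>_. 1"] by simp

lemma square_integrable_scale: "square_integrable f \<Longrightarrow> square_integrable (\<lambda>x. c * f x)"
  by (auto simp: square_integrable_def power_mult_distrib)

lemma square_integrable_add:
  assumes "square_integrable f" "square_integrable g"
  shows "square_integrable (\<lambda>x. f x + g x)"
  using square_integrable_mult[OF assms] assms
  by (auto simp: square_integrable_def power2_sum mult.assoc)

lemma square_integrable_diff:
  assumes "square_integrable f" "square_integrable g"
  shows "square_integrable (\<lambda>x. f x - g x)"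
  using square_integrable_add[OF assms(1) square_integrable_scale[OF assms(2), of "-1"]] by simp

lemma square_integrable_sum:
  assumes "\<And>i. i \<in> I \<Longrightarrow> square_integrable (f i)"
  shows "square_integrable (\<lambda>x. \<Sum>i\<in>I. f i x)"
  using assms by (induction I rule: infinite_finite_induct) (auto intro: square_integrable_add)

text \<open>
  The quadratic polynomial \<open>t \<mapsto> \<integral> (f + t g)\<^sup>2\<close> is nonnegative.
\<close>

lemma Cauchy_Schwarz_circ:
  assumes f: "square_integrable f" and g: "square_integrable g"
  shows "(integral\<^sup>L circ (\<lambda>x. f x * g x))\<^sup>2 \<le>
    integral\<^sup>L circ (\<lambda>x. (f x)\<^sup>2) * integral\<^sup>L circ (\<lambda>x. (g x)\<^sup>2)"
proof -
  define A where "A = integral\<^sup>L circ (\<lambda>x. (f x)\<^sup>2)"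
  define B where "B = integral\<^sup>L circ (\<lambda>x. f x * g x)"
  define C where "C = integral\<^sup>L circ (\<lambda>x. (g x)\<^sup>2)"
  have q: "0 \<le> A + 2 * t * B + t\<^sup>2 * C" for t
  proof -
    have "0 \<le> integral\<^sup>L circ (\<lambda>x. (f x + t * g x)\<^sup>2)" by simp
    also have "(\<lambda>x. (f x + t * g x)\<^sup>2) = (\<lambda>x. (f x)\<^sup>2 + (2 * t) * (f x * g x) + t\<^sup>2 * (g x)\<^sup>2)"
      by (simp add: power2_sum power_mult_distrib algebra_simps fun_eq_iff)
    also have "integral\<^sup>L circ \<dots> = A + 2 * t * B + t\<^sup>2 * C"
      using square_integrableD(3)[OF f] square_integrableD(3)[OF g] square_integrable_mult[OF f g]
      by (simp add: A_def B_def C_def)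
    finally show ?thesis .
  qed
  have C0: "0 \<le> C" by (simp add: C_def)
  have "B\<^sup>2 \<le> A * C"
  proof (cases "C = 0")
    case True
    have "B = 0"
    proof (rule ccontr)
      assume "B \<noteq> 0"
      \<comment> \<open>For \<open>C = 0\<close> the polynomial is affine; this argument gives it the value \<open>-1\<close>.\<close>
      then show False using q[of "- (A + 1) / (2 * B)"] True by (simp add: field_simps)
    qed
    with True show ?thesis by simp
  next
    case False
    with C0 have "0 < C" by simp
    with q[of "- B / C"] show ?thesis by (simp add: field_simps power2_eq_square)
  qed
  then show ?thesis by (simp add: A_def B_def C_def)
qed

definition L2_tendsto :: "(nat \<Rightarrow> real \<Rightarrow> real) \<Rightarrow> (real \<Rightarrow> real) \<Rightarrow> bool" where
  "L2_tendsto F f \<longleftrightarrow> (\<forall>n. square_integrable (F n)) \<and> square_integrable f \<and>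
     (\<lambda>n. integral\<^sup>L circ (\<lambda>x. (F n x - f x)\<^sup>2)) \<longlonglongrightarrow> 0"

lemma L2_tendsto_inner:
  assumes F: "L2_tendsto F f" and g: "square_integrable g"
  shows "(\<lambda>n. integral\<^sup>L circ (\<lambda>x. F n x * g x)) \<longlonglongrightarrow> integral\<^sup>L circ (\<lambda>x. f x * g x)"
proof -
  note F' = F[unfolded L2_tendsto_def]
  have d: "square_integrable (\<lambda>x. F n x - f x)" for n
    using F' by (blast intro: square_integrable_diff)
  have "(\<lambda>n. (integral\<^sup>L circ (\<lambda>x. (F n x - f x) * g x))\<^sup>2) \<longlonglongrightarrow> 0"
  proof (rule tendsto_sandwich[OF _ _ tendsto_const])
    show "\<forall>\<^sub>F n in sequentially. (integral\<^sup>L circ (\<lambda>x. (F n x - f x) * g x))\<^sup>2 \<le>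
       integral\<^sup>L circ (\<lambda>x. (F n x - f x)\<^sup>2) * integral\<^sup>L circ (\<lambda>x. (g x)\<^sup>2)"
      using Cauchy_Schwarz_circ[OF d g] by (intro always_eventually) auto
    show "(\<lambda>n. integral\<^sup>L circ (\<lambda>x. (F n x - f x)\<^sup>2) * integral\<^sup>L circ (\<lambda>x. (g x)\<^sup>2)) \<longlonglongrightarrow> 0"
      using F' by (intro tendsto_mult_left_zero) auto
  qed auto
  then have "(\<lambda>n. integral\<^sup>L circ (\<lambda>x. (F n x - f x) * g x)) \<longlonglongrightarrow> 0"
    by simp
  moreover have "integral\<^sup>L circ (\<lambda>x. (F n x - f x) * g x) =
      integral\<^sup>L circ (\<lambda>x. F n x * g x) - integral\<^sup>L circ (\<lambda>x. f x * g x)" for n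
    using F' g by (simp add: left_diff_distrib square_integrable_mult)
  ultimately show ?thesis by (simp add: LIM_zero_iff)
qed

lemma L2_tendsto_norm:
  assumes F: "L2_tendsto F f"
  shows "(\<lambda>n. integral\<^sup>L circ (\<lambda>x. (F n x)\<^sup>2)) \<longlonglongrightarrow> integral\<^sup>L circ (\<lambda>x. (f x)\<^sup>2)"
proof -
  note F' = F[unfolded L2_tendsto_def]
  have f: "square_integrable f" and Fn: "square_integrable (F n)" for n using F' by auto
  have "integral\<^sup>L circ (\<lambda>x. (F n x)\<^sup>2) = integral\<^sup>L circ (\<lambda>x. (F n x - f x)\<^sup>2)
     + 2 * integral\<^sup>L circ (\<lambda>x. F n x * f x) - integral\<^sup>L circ (\<lambda>x. f x * f x)" for n
  proof -
    have "(\<lambda>x. (F n x)\<^sup>2) = (\<lambda>x. (F n x - f x)\<^sup>2 + 2 * (F n x * f x) - f x * f x)"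
      by (simp add: fun_eq_iff power2_eq_square algebra_simps)
    then show ?thesis
      using square_integrableD(3)[OF square_integrable_diff[OF Fn[of n] f]]
        square_integrable_mult[OF Fn[of n] f] square_integrable_mult[OF f f]
      by simp
  qed
  moreover have "(\<lambda>n. integral\<^sup>L circ (\<lambda>x. (F n x - f x)\<^sup>2)
     + 2 * integral\<^sup>L circ (\<lambda>x. F n x * f x) - integral\<^sup>L circ (\<lambda>x. f x * f x))
     \<longlonglongrightarrow> 0 + 2 * integral\<^sup>L circ (\<lambda>x. f x * f x) - integral\<^sup>L circ (\<lambda>x. f x * f x)"
    using F' by (intro tendsto_intros L2_tendsto_inner[OF F f]) auto
  ultimately show ?thesis by (simp add: power2_eq_square)
qed

lemma L2_tendsto_AE_subseq:
  assumes F: "L2_tendsto F f"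
  obtains r :: "nat \<Rightarrow> nat" where "strict_mono r" "AE x in circ. (\<lambda>n. F (r n) x) \<longlonglongrightarrow> f x"
proof -
  note F' = F[unfolded L2_tendsto_def]
  have "\<exists>r::nat\<Rightarrow>nat. strict_mono r \<and> (AE x in circ. (\<lambda>n. (F (r n) x - f x)\<^sup>2) \<longlonglongrightarrow> 0)"
    using F' by (intro tendsto_L1_AE_subseq square_integrableD(3) square_integrable_diff) auto
  then obtain r where r: "strict_mono r" "AE x in circ. (\<lambda>n. (F (r n) x - f x)\<^sup>2) \<longlonglongrightarrow> 0" by blast
  from r(2) have "AE x in circ. (\<lambda>n. F (r n) x) \<longlonglongrightarrow> f x"
    by eventually_elim (simp add: LIM_zero_iff)
  with r(1) show ?thesis by (rule that)
qed

text \<open>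
  The heart of the completeness of \<open>L\<^sup>2\<close>. Along a subsequence whose consecutive differences \<open>D\<^sub>j\<close>
  satisfy \<open>\<integral> D\<^sub>j\<^sup>2 \<le> 4\<^sup>-\<^sup>j\<close>, the integrals \<open>\<integral> D\<^sub>j\<close> are summable, so \<open>\<Sum> D\<^sub>j\<close> is finite almost
  everywhere and the telescoping series converges there.
\<close>

lemma L2_Cauchy_AE_convergent:
  assumes F: "\<And>n. square_integrable (F n)"
    and Cauchy: "\<And>e. e > 0 \<Longrightarrow> \<exists>N. \<forall>m\<ge>N. \<forall>n\<ge>N. integral\<^sup>L circ (\<lambda>x. (F m x - F n x)\<^sup>2) < e"
  obtains r :: "nat \<Rightarrow> nat" where "strict_mono r" "AE x in circ. convergent (\<lambda>n. F (r n) x)"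
proof -
  have "\<exists>N. \<forall>m\<ge>N. \<forall>n\<ge>N. integral\<^sup>L circ (\<lambda>x. (F m x - F n x)\<^sup>2) < (1/4)^j" for j :: nat
    by (rule Cauchy) simp
  then obtain N where N: "\<And>j m n. m \<ge> N j \<Longrightarrow> n \<ge> N j \<Longrightarrow> integral\<^sup>L circ (\<lambda>x. (F m x - F n x)\<^sup>2) < (1/4)^j"
    by metis
  \<comment> \<open>The summand \<open>j\<close> makes \<open>r\<close> strictly monotone, the sum makes it exceed \<open>N j\<close>.\<close>
  define r where "r j = j + (\<Sum>i\<le>j. N i)" for j
  have r: "strict_mono r" by (rule strict_monoI_Suc) (simp add: r_def)
  have rN: "r j \<ge> N j" for j
    unfolding r_def using member_le_sum[of j "{..j}" N] by simp
  define D where "D j x = \<bar>F (r (Suc j)) x - F (r j) x\<bar>" for j x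
  have d: "square_integrable (\<lambda>x. F (r (Suc j)) x - F (r j) x)" for j
    by (intro square_integrable_diff F)
  have Di: "integrable circ (D j)" for j
    unfolding D_def by (intro integrable_abs square_integrable_imp_integrable d)
  have Dsq: "integrable circ (\<lambda>x. (D j x)\<^sup>2)" for j
    unfolding D_def using square_integrableD(3)[OF d] by simp
  have Db: "integral\<^sup>L circ (D j) \<le> (2 * pi + 1) * (1/2)^j" for j
  proof -
    \<comment> \<open>The arithmetic-geometric mean inequality replaces Cauchy--Schwarz against the constant \<open>1\<close>.\<close>
    have am: "D j x \<le> (1/2)^j + 2^j * (D j x)\<^sup>2" for x
    proof -
      have "0 \<le> 2^j * (D j x - (1/2)^j)\<^sup>2" by simp
      also have "\<dots> = 2^j * (D j x)\<^sup>2 - 2 * D j x + (1/2)^j"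
        by (simp add: power2_eq_square algebra_simps power_one_over)
      finally have "2 * D j x \<le> (1/2)^j + 2^j * (D j x)\<^sup>2" by simp
      moreover have "0 \<le> D j x" by (simp add: D_def)
      ultimately show ?thesis by linarith
    qed
    have "integral\<^sup>L circ (D j) \<le> integral\<^sup>L circ (\<lambda>x. (1/2)^j + 2^j * (D j x)\<^sup>2)"
      by (intro integral_mono Di am) (use Dsq in auto)
    also have "\<dots> = 2 * pi * (1/2)^j + 2^j * integral\<^sup>L circ (\<lambda>x. (D j x)\<^sup>2)"
      using Dsq[of j] by (simp add: measure_def emeasure_circ)
    also have "integral\<^sup>L circ (\<lambda>x. (D j x)\<^sup>2) \<le> (1/4)^j"
      unfolding D_def power2_abs
      using N[of j "r (Suc j)" "r j"] rN[of j] strict_mono_leD[OF r, of j "Suc j"] by simp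
    also have "(2::real)^j * (1/4)^j = (1/2)^j"
      by (simp add: power_mult_distrib[symmetric])
    finally show ?thesis by (simp add: algebra_simps)
  qed
  have "(\<integral>\<^sup>+x. (\<Sum>j. ennreal (D j x)) \<partial>circ) = (\<Sum>j. \<integral>\<^sup>+x. ennreal (D j x) \<partial>circ)"
    using Di by (intro nn_integral_suminf) auto
  also have "\<dots> = (\<Sum>j. ennreal (integral\<^sup>L circ (D j)))"
    by (intro suminf_cong nn_integral_eq_integral Di) (simp add: D_def)
  also have "\<dots> \<le> (\<Sum>j. ennreal ((2 * pi + 1) * (1/2)^j))"
    by (intro suminf_le ennreal_leI Db) auto
  also have "\<dots> < top"
    by (subst suminf_ennreal2) (auto intro!: summable_mult summable_geometric)
  finally have fin: "(\<integral>\<^sup>+x. (\<Sum>j. ennreal (D j x)) \<partial>circ) < top" .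
  have "AE x in circ. (\<Sum>j. ennreal (D j x)) \<noteq> \<infinity>"
    using Di fin by (intro nn_integral_PInf_AE) auto
  then have "AE x in circ. convergent (\<lambda>n. F (r n) x)"
  proof eventually_elim
    case (elim x)
    then have "summable (\<lambda>j. D j x)"
      by (intro summable_suminf_not_top) (auto simp: D_def)
    then have "summable (\<lambda>j. F (r (Suc j)) x - F (r j) x)"
      unfolding D_def by (rule summable_rabs_cancel)
    then have "convergent (\<lambda>n. \<Sum>j<n. (F (r (Suc j)) x - F (r j) x))"
      by (simp add: summable_iff_convergent)
    then have "convergent (\<lambda>n. F (r n) x - F (r 0) x)"
      by (simp only: sum_lessThan_telescope[of "\<lambda>j. F (r j) x"])
    then show ?case
      using convergent_add[OF _ convergent_const[of "F (r 0) x"]] by fastforce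
  qed
  with r show ?thesis by (rule that)
qed

text \<open>
  An almost everywhere limit of a subsequence is the \<open>L\<^sup>2\<close> limit of a Cauchy sequence: Fatou's
  lemma is applied to \<open>(F\<^sub>m - F\<^sub>n)\<^sup>2\<close> with \<open>n\<close> fixed and \<open>m\<close> running through the subsequence.
\<close>

lemma L2_Cauchy_tendsto:
  assumes F: "\<And>n. square_integrable (F n)"
    and Cauchy: "\<And>e. e > 0 \<Longrightarrow> \<exists>N. \<forall>m\<ge>N. \<forall>n\<ge>N. integral\<^sup>L circ (\<lambda>x. (F m x - F n x)\<^sup>2) < e"
    and r: "strict_mono r" and lim: "AE x in circ. (\<lambda>j. F (r j) x) \<longlonglongrightarrow> f x"
    and f: "f \<in> borel_measurable borel"
  shows "L2_tendsto F f"
proof -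
  have *: "integrable circ (\<lambda>x. (f x - F n x)\<^sup>2) \<and> integral\<^sup>L circ (\<lambda>x. (f x - F n x)\<^sup>2) \<le> e"
    if e: "\<forall>m\<ge>N. integral\<^sup>L circ (\<lambda>x. (F m x - F n x)\<^sup>2) < e" for N n e
  proof -
    have l: "AE x in circ. (\<lambda>j. (F (r (j + N)) x - F n x)\<^sup>2) \<longlonglongrightarrow> (f x - F n x)\<^sup>2"
      using lim by eventually_elim (intro tendsto_intros LIMSEQ_ignore_initial_segment)
    have b: "integral\<^sup>L circ (\<lambda>x. (F (r (j + N)) x - F n x)\<^sup>2) \<le> e" for j
      using e seq_suble[OF r, of "j + N"] by (simp add: less_imp_le)
    have i: "integrable circ (\<lambda>x. (F (r (j + N)) x - F n x)\<^sup>2)" for j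
      by (intro square_integrableD(3) square_integrable_diff F)
    have m: "(\<lambda>x. (f x - F n x)\<^sup>2) \<in> borel_measurable circ"
      using f square_integrableD(1)[OF F] by (intro measurable_circ) auto
    show ?thesis using Fatou_integral[OF i _ m _ l b tendsto_const] by simp
  qed
  have sq: "square_integrable f"
  proof -
    obtain N where N: "\<forall>m\<ge>N. \<forall>n\<ge>N. integral\<^sup>L circ (\<lambda>x. (F m x - F n x)\<^sup>2) < 1"
      using Cauchy[of 1] by auto
    have "integrable circ (\<lambda>x. (f x - F N x)\<^sup>2)" using *[of N N 1] N by blast
    then have "square_integrable (\<lambda>x. f x - F N x)"
      using f square_integrableD(1)[OF F] by (simp add: square_integrable_def)
    from square_integrable_add[OF this F[of N]] show ?thesis by simp
  qed
  have "(\<lambda>n. integral\<^sup>L circ (\<lambda>x. (F n x - f x)\<^sup>2)) \<longlonglongrightarrow> 0"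
  proof (rule LIMSEQ_I)
    fix e :: real assume e: "e > 0"
    obtain N where N: "\<forall>m\<ge>N. \<forall>n\<ge>N. integral\<^sup>L circ (\<lambda>x. (F m x - F n x)\<^sup>2) < e/2"
      using Cauchy[of "e/2"] e by auto
    have "integral\<^sup>L circ (\<lambda>x. (F n x - f x)\<^sup>2) \<le> e/2" if "n \<ge> N" for n
      using *[of N n "e/2"] N that by (simp add: power2_commute)
    with e show "\<exists>N. \<forall>n\<ge>N. norm (integral\<^sup>L circ (\<lambda>x. (F n x - f x)\<^sup>2) - 0) < e"
      by (intro exI[of _ N]) (fastforce)
  qed
  with F sq show ?thesis by (simp add: L2_tendsto_def)
qed

section \<open>Sine series and the Riesz--Fischer theorem\<close>

lemma integral_circ_cos:
  "integral\<^sup>L circ (\<lambda>x. cos (of_int k * x)) = (if k = 0 then 2 * pi else 0)"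
proof (cases "k = 0")
  case True
  then show ?thesis by (simp add: measure_def emeasure_circ)
next
  case False
  have "integral\<^sup>L circ (\<lambda>x. cos (of_int k * x)) = (\<integral>x. cos (of_int k * x) * indicator {-pi..pi} x \<partial>lborel)"
    by (simp add: set_integral_circ[symmetric] set_lebesgue_integral_def mult.commute)
  also have "\<dots> = sin (of_int k * pi) / of_int k - sin (of_int k * (-pi)) / of_int k"
  proof (rule integral_FTC_Icc_real)
    fix x :: real
    show "((\<lambda>x. sin (of_int k * x) / of_int k) has_real_derivative cos (of_int k * x)) (at x)"
      using False by (auto intro!: derivative_eq_intros)
  qed (auto intro!: continuous_intros)
  also have "\<dots> = 0" by (simp add: sin_zero_iff_int2)
  finally show ?thesis using False by simp
qed

lemma integrable_circ_cos [simp]: "integrable circ (\<lambda>x. cos (a * x))"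
  by (intro square_integrable_imp_integrable square_integrable_bounded[of _ 1]) auto

lemma integral_circ_sin_sin:
  "integral\<^sup>L circ (\<lambda>x. sin (real j * x) * sin (real k * x)) = (if j = k \<and> j \<noteq> 0 then pi else 0)"
proof -
  have "sin (real j * x) * sin (real k * x)
     = cos (of_int (int j - int k) * x) / 2 - cos (of_int (int j + int k) * x) / 2" for x
    by (simp add: left_diff_distrib distrib_right cos_diff cos_add add_divide_distrib diff_divide_distrib)
  then have "integral\<^sup>L circ (\<lambda>x. sin (real j * x) * sin (real k * x))
     = (integral\<^sup>L circ (\<lambda>x. cos (of_int (int j - int k) * x)) -
        integral\<^sup>L circ (\<lambda>x. cos (of_int (int j + int k) * x))) / 2"
    by (simp only:) (subst Bochner_Integration.integral_diff, simp_all only: integrable_circ_cos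
        integrable_divide integral_divide_zero diff_divide_distrib)
  then show ?thesis unfolding integral_circ_cos by auto
qed

text \<open>
  With the factor \<open>1 / \<pi>\<close> the coefficients of a sine polynomial are recovered unchanged. The index
  starts at \<open>0\<close>, where the coefficient of every function is zero; sequences of prescribed
  coefficients are therefore required to vanish at \<open>0\<close>.
\<close>

definition sine_coeff :: "(real \<Rightarrow> real) \<Rightarrow> nat \<Rightarrow> real" where
  "sine_coeff f k = integral\<^sup>L circ (\<lambda>x. f x * sin (real k * x)) / pi"

definition sine_poly :: "(nat \<Rightarrow> real) \<Rightarrow> nat \<Rightarrow> real \<Rightarrow> real" where
  "sine_poly b n x = (\<Sum>k<n. b k * sin (real k * x))"

lemma sine_coeff_0 [simp]: "sine_coeff f 0 = 0"
  by (simp add: sine_coeff_def)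

lemma square_integrable_sine_poly [simp]: "square_integrable (sine_poly b n)"
  unfolding sine_poly_def by (intro square_integrable_sum square_integrable_scale) simp

lemma integral_mult_sine_poly:
  assumes "square_integrable f"
  shows "integral\<^sup>L circ (\<lambda>x. f x * sine_poly b n x) = pi * (\<Sum>k<n. b k * sine_coeff f k)"
proof -
  have "(\<lambda>x. f x * sine_poly b n x) = (\<lambda>x. \<Sum>k<n. b k * (f x * sin (real k * x)))"
    by (simp add: sine_poly_def sum_distrib_left fun_eq_iff mult.left_commute)
  then show ?thesis
    using square_integrable_mult[OF assms square_integrable_sin]
    by (simp add: sine_coeff_def sum_distrib_left)
qed

lemma sine_coeff_sine_poly:
  assumes "b 0 = 0"
  shows "sine_coeff (sine_poly b n) k = (if k < n then b k else 0)"
proof -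
  have "integral\<^sup>L circ (\<lambda>x. sin (real k * x) * sine_poly b n x)
     = (\<Sum>j<n. b j * (if k = j \<and> k \<noteq> 0 then pi else 0))"
    unfolding integral_mult_sine_poly[OF square_integrable_sin] sine_coeff_def integral_circ_sin_sin
      sum_distrib_left
    by (intro sum.cong) auto
  also have "\<dots> = (\<Sum>j<n. if k = j then b j * pi else 0)"
    using assms by (intro sum.cong) auto
  also have "\<dots> = (if k < n then b k * pi else 0)" by simp
  finally show ?thesis by (simp add: sine_coeff_def mult.commute)
qed

lemma integral_sine_poly_square:
  assumes "b 0 = 0"
  shows "integral\<^sup>L circ (\<lambda>x. (sine_poly b n x)\<^sup>2) = pi * (\<Sum>k<n. (b k)\<^sup>2)"
proof -
  have "(\<Sum>k<n. b k * sine_coeff (sine_poly b n) k) = (\<Sum>k<n. (b k)\<^sup>2)"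
    using sine_coeff_sine_poly[of b, OF assms]
    by (intro sum.cong) (simp_all add: power2_eq_square)
  with integral_mult_sine_poly[OF square_integrable_sine_poly, of b n b n]
  show ?thesis by (simp add: power2_eq_square)
qed

lemma sine_poly_diff:
  "n \<le> m \<Longrightarrow> sine_poly b m x - sine_poly b n x = sine_poly (\<lambda>k. if n \<le> k then b k else 0) m x"
proof -
  assume "n \<le> m"
  then have "sine_poly b m x = sine_poly b n x + (\<Sum>k\<in>{n..<m}. b k * sin (real k * x))"
    unfolding sine_poly_def lessThan_atLeast0
    using sum.atLeastLessThan_concat[of 0 n m "\<lambda>k. b k * sin (real k * x)"] by linarith
  moreover have "sine_poly (\<lambda>k. if n \<le> k then b k else 0) m x = (\<Sum>k\<in>{n..<m}. b k * sin (real k * x))"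
    unfolding sine_poly_def
    by (rule sum.mono_neutral_cong_right) auto
  ultimately show ?thesis by simp
qed

lemma sine_poly_Cauchy:
  assumes b0: "b 0 = 0" and b: "summable (\<lambda>k. (b k)\<^sup>2)" and e: "e > 0"
  shows "\<exists>N. \<forall>m\<ge>N. \<forall>n\<ge>N. integral\<^sup>L circ (\<lambda>x. (sine_poly b m x - sine_poly b n x)\<^sup>2) < e"
proof -
  obtain N where N: "\<And>m n. m \<ge> N \<Longrightarrow> norm (\<Sum>k\<in>{m..<n}. (b k)\<^sup>2) < e / pi"
    using b e unfolding summable_Cauchy by (metis divide_pos_pos pi_gt_zero)
  have *: "integral\<^sup>L circ (\<lambda>x. (sine_poly b m x - sine_poly b n x)\<^sup>2) < e" if "N \<le> n" "n \<le> m" for m n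
  proof -
    have "integral\<^sup>L circ (\<lambda>x. (sine_poly b m x - sine_poly b n x)\<^sup>2)
       = pi * (\<Sum>k<m. (if n \<le> k then b k else 0)\<^sup>2)"
      using b0 that(2) by (simp add: sine_poly_diff integral_sine_poly_square)
    also have "(\<Sum>k<m. (if n \<le> k then b k else 0)\<^sup>2) = (\<Sum>k\<in>{n..<m}. (b k)\<^sup>2)"
      by (rule sum.mono_neutral_cong_right) auto
    also have "pi * \<dots> < e"
      using N[OF that(1), of m] by (simp add: field_simps sum_nonneg)
    finally show ?thesis .
  qed
  have "integral\<^sup>L circ (\<lambda>x. (sine_poly b m x - sine_poly b n x)\<^sup>2) < e" if "N \<le> n" "N \<le> m" for m n
    using *[of n m] *[of m n] that by (cases "n \<le> m") (auto simp: power2_commute)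
  then show ?thesis by blast
qed

lemma sin_nat_periodic: "sin (real k * (x + 2 * pi)) = sin (real k * x)"
proof -
  have "real k * (x + 2 * pi) = real k * x + of_nat k * (2 * of_real pi)"
    by (simp add: algebra_simps)
  then show ?thesis by (simp only: sin.plus_of_nat)
qed

lemma sine_poly_periodic: "sine_poly b n (x + 2 * pi) = sine_poly b n x"
  by (simp only: sine_poly_def sin_nat_periodic)

lemma sine_poly_odd: "sine_poly b n (- x) = - sine_poly b n x"
  by (simp add: sine_poly_def sum_negf)

text \<open>
  The partial sums are a Cauchy sequence by orthogonality. The limit is taken pointwise along a
  subsequence and set to \<open>0\<close> where that subsequence diverges, so that it inherits periodicity and
  oddness at every point from the partial sums.
\<close>

theorem Riesz_Fischer_sine:
  assumes b0: "b 0 = 0" and b: "summable (\<lambda>k. (b k)\<^sup>2)"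
  obtains f where "periodic_2pi f" "\<And>x. f (- x) = - f x" "L2_tendsto (sine_poly b) f"
proof -
  obtain r :: "nat \<Rightarrow> nat" where r: "strict_mono r"
    and conv: "AE x in circ. convergent (\<lambda>n. sine_poly b (r n) x)"
    using L2_Cauchy_AE_convergent[of "sine_poly b", OF _ sine_poly_Cauchy[OF b0 b]] by auto
  define f where "f x = (if convergent (\<lambda>n. sine_poly b (r n) x) then lim (\<lambda>n. sine_poly b (r n) x) else 0)" for x
  have [measurable]: "sine_poly b n \<in> borel_measurable borel" for n
    by (intro square_integrableD(1)) simp
  have m: "f \<in> borel_measurable borel" unfolding f_def
    unfolding Cauchy_convergent_iff[symmetric] by measurable
  have "AE x in circ. (\<lambda>n. sine_poly b (r n) x) \<longlonglongrightarrow> f x"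
    using conv by eventually_elim (simp add: f_def convergent_LIMSEQ_iff)
  then have "L2_tendsto (sine_poly b) f"
    by (intro L2_Cauchy_tendsto[OF _ sine_poly_Cauchy[OF b0 b] r _ m]) auto
  moreover have "periodic_2pi f" by (simp add: periodic_2pi_def f_def sine_poly_periodic)
  moreover have "f (- x) = - f x" for x
  proof (cases "convergent (\<lambda>n. sine_poly b (r n) x)")
    case True
    then have "(\<lambda>n. sine_poly b (r n) x) \<longlonglongrightarrow> f x" by (simp add: f_def convergent_LIMSEQ_iff)
    then have "(\<lambda>n. sine_poly b (r n) (- x)) \<longlonglongrightarrow> - f x" by (simp add: sine_poly_odd tendsto_minus)
    then show ?thesis by (auto simp: f_def limI convergent_def)
  next
    case False
    then show ?thesis by (simp add: f_def sine_poly_odd convergent_minus_iff[symmetric])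
  qed
  ultimately show ?thesis by (intro that)
qed

lemma L2_tendsto_sine_poly:
  assumes b0: "b 0 = 0" and f: "L2_tendsto (sine_poly b) f"
  shows "sine_coeff f k = b k" "integral\<^sup>L circ (\<lambda>x. (f x)\<^sup>2) = pi * (\<Sum>k. (b k)\<^sup>2)"
proof -
  have "(\<lambda>n. sine_coeff (sine_poly b n) k) \<longlonglongrightarrow> sine_coeff f k"
    unfolding sine_coeff_def by (intro tendsto_divide tendsto_const L2_tendsto_inner[OF f]) auto
  moreover have "(\<lambda>n. sine_coeff (sine_poly b n) k) \<longlonglongrightarrow> b k"
    by (intro tendsto_eventually eventually_mono[OF eventually_gt_at_top[of k]])
      (simp add: sine_coeff_sine_poly[of b, OF b0])
  ultimately show "sine_coeff f k = b k"
    by (rule LIMSEQ_unique)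
  have "(\<lambda>n. (\<Sum>k<n. (b k)\<^sup>2)) \<longlonglongrightarrow> integral\<^sup>L circ (\<lambda>x. (f x)\<^sup>2) / pi"
    using tendsto_divide[OF L2_tendsto_norm[OF f] tendsto_const[of pi]]
    by (simp add: integral_sine_poly_square[of b, OF b0])
  then have "(\<Sum>k. (b k)\<^sup>2) = integral\<^sup>L circ (\<lambda>x. (f x)\<^sup>2) / pi"
    by (intro sums_unique[symmetric]) (simp only: sums_def)
  then show "integral\<^sup>L circ (\<lambda>x. (f x)\<^sup>2) = pi * (\<Sum>k. (b k)\<^sup>2)" by simp
qed

text \<open>
  Oddness is required only almost everywhere on one period, the form in which it is available for
  elements of the Sobolev spaces.
\<close>

definition odd_integrable :: "(real \<Rightarrow> real) \<Rightarrow> bool" where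
  "odd_integrable u \<longleftrightarrow> u \<in> borel_measurable borel \<and> integrable circ u \<and> (AE x in circ. u (- x) = - u x)"

lemma integral_circ_reflect: "integral\<^sup>L circ f = integral\<^sup>L circ (\<lambda>x. f (- x))"
  for f :: "real \<Rightarrow> real"
proof -
  have "{x. - x \<in> {-pi..pi}} = {-pi..pi}" by auto
  then show ?thesis
    using set_integral_reflect[of "{-pi..pi}" f] by (simp add: set_integral_circ)
qed

lemma odd_integrable_integral_even_zero:
  assumes u: "odd_integrable u" and h: "h \<in> borel_measurable borel" "\<And>x. h (- x) = (h x :: real)"
  shows "integral\<^sup>L circ (\<lambda>x. u x * h x) = 0"
proof -
  have [measurable]: "u \<in> borel_measurable borel" "h \<in> borel_measurable borel"
    using u h by (auto simp: odd_integrable_def)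
  have "integral\<^sup>L circ (\<lambda>x. u x * h x) = integral\<^sup>L circ (\<lambda>x. u (- x) * h (- x))"
    by (rule integral_circ_reflect)
  also have "\<dots> = integral\<^sup>L circ (\<lambda>x. - (u x * h x))"
  proof (rule integral_cong_AE)
    have "AE x in circ. u (- x) = - u x" using u by (simp add: odd_integrable_def)
    then show "AE x in circ. u (- x) * h (- x) = - (u x * h x)"
      by eventually_elim (simp add: h)
  qed (auto intro!: measurable_circ)
  finally show ?thesis by simp
qed

lemma fourier_coeff_odd:
  assumes u: "odd_integrable u"
  shows "fourier_coeff u k = Complex 0 (- (of_int (sgn k) * sine_coeff u (nat \<bar>k\<bar>) / 2))"
proof -
  have i: "integrable circ u" using u by (simp add: odd_integrable_def)
  have "integral\<^sup>L circ (\<lambda>x. u x * cos (of_int k * x)) = 0"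
    by (intro odd_integrable_integral_even_zero[OF u]) auto
  moreover have "integral\<^sup>L circ (\<lambda>x. u x * sin (of_int k * x)) = pi * (of_int (sgn k) * sine_coeff u (nat \<bar>k\<bar>))"
    by (cases k "0::int" rule: linorder_cases) (simp_all add: sine_coeff_def)
  ultimately show ?thesis by (simp add: fourier_coeff_circ[OF i])
qed

lemma odd_integrable_determined:
  assumes "odd_integrable u" "odd_integrable v" "\<And>k. sine_coeff u k = sine_coeff v k"
  shows "AE x in circ. u x = v x"
proof (rule fourier_coeff_determines)
  show "fourier_coeff u k = fourier_coeff v k" for k
    using assms by (simp add: fourier_coeff_odd)
qed (use assms in \<open>auto simp: odd_integrable_def\<close>)

lemma L2_tendsto_cong_AE:
  assumes "L2_tendsto F f" "AE x in circ. f x = g x" "g \<in> borel_measurable borel"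
  shows "L2_tendsto F g"
proof -
  have F: "square_integrable (F n)" "square_integrable f" for n
    using assms(1) by (auto simp: L2_tendsto_def)
  note [measurable] = square_integrableD(1)[OF F(1)] square_integrableD(1)[OF F(2)] assms(3)
  have "integrable circ (\<lambda>x. (g x)\<^sup>2)"
    by (rule integrable_cong_AE_imp[OF square_integrableD(3)[OF F(2)]])
       (use assms(2) in \<open>auto intro!: measurable_circ elim: eventually_mono\<close>)
  moreover have "integral\<^sup>L circ (\<lambda>x. (F n x - f x)\<^sup>2) = integral\<^sup>L circ (\<lambda>x. (F n x - g x)\<^sup>2)" for n
    by (rule integral_cong_AE) (use assms(2) in \<open>auto intro!: measurable_circ elim: eventually_mono\<close>)
  ultimately show ?thesis
    using assms by (simp add: L2_tendsto_def square_integrable_def)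
qed

lemma square_integrable_odd_integrable:
  assumes "square_integrable u" "AE x in circ. u (- x) = - u x"
  shows "odd_integrable u"
  using assms square_integrable_imp_integrable[OF assms(1)]
  by (simp add: odd_integrable_def square_integrable_def)

text \<open>
  The function that Riesz--Fischer builds from the coefficients of \<open>u\<close> has the same coefficients as
  \<open>u\<close>, and integrable functions are determined by them.
\<close>

lemma sine_series_L2:
  assumes u: "square_integrable u" "AE x in circ. u (- x) = - u x"
    and s: "summable (\<lambda>k. (sine_coeff u k)\<^sup>2)"
  shows "L2_tendsto (sine_poly (sine_coeff u)) u"
proof -
  obtain f where f: "\<And>x. f (- x) = - f x" "L2_tendsto (sine_poly (sine_coeff u)) f"
    using Riesz_Fischer_sine[of "sine_coeff u"] s by auto
  have "odd_integrable f"
    using f by (intro square_integrable_odd_integrable AE_I2) (auto simp: L2_tendsto_def)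
  moreover have "odd_integrable u" by (rule square_integrable_odd_integrable[OF u])
  moreover have "sine_coeff f k = sine_coeff u k" for k
    using L2_tendsto_sine_poly(1)[of "sine_coeff u" f k] f(2) by simp
  ultimately have "AE x in circ. f x = u x" by (rule odd_integrable_determined)
  from L2_tendsto_cong_AE[OF f(2) this] show ?thesis
    using u by (simp add: square_integrable_def)
qed

lemma Parseval_sine:
  assumes u: "square_integrable u" "AE x in circ. u (- x) = - u x"
    and s: "summable (\<lambda>k. (sine_coeff u k)\<^sup>2)"
  shows "integral\<^sup>L circ (\<lambda>x. (u x)\<^sup>2) = pi * (\<Sum>k. (sine_coeff u k)\<^sup>2)"
  using L2_tendsto_sine_poly(2)[of "sine_coeff u" u] sine_series_L2[OF assms] by simp

section \<open>Odd Sobolev functions in terms of sine coefficients\<close>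

text \<open>
  Translates the sums over all integer frequencies in the Sobolev norms into series over the
  natural numbers.
\<close>

lemma even_int_sum:
  fixes g :: "int \<Rightarrow> real"
  assumes g0: "g 0 = 0" and nonneg: "\<And>k. 0 \<le> g k" and even: "\<And>k. g (- k) = g k"
  shows "g summable_on UNIV \<longleftrightarrow> summable (\<lambda>n. g (int n))"
    and "summable (\<lambda>n. g (int n)) \<Longrightarrow> infsum g UNIV = 2 * (\<Sum>n. g (int n))"
proof -
  have *: "(g has_sum 2 * (\<Sum>n. g (int n))) UNIV" if s: "summable (\<lambda>n. g (int n))"
  proof -
    define S where "S = (\<Sum>n. g (int n))"
    have S: "((\<lambda>n. g (int n)) has_sum S) UNIV"
      unfolding S_def using s nonneg by (intro sums_nonneg_imp_has_sum summable_sums) auto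
    have pos: "(g has_sum S) {0..}"
      by (rule has_sum_reindex_bij_witness[of _ nat int, THEN iffD1, OF _ _ _ _ _ refl S]) auto
    have S': "((\<lambda>n. g (int n)) has_sum S) {0<..}"
      using S by (rule has_sum_cong_neutral[THEN iffD1, rotated -1]) (use g0 in auto)
    have neg: "(g has_sum S) {..<0}"
      by (rule has_sum_reindex_bij_witness[of _ "\<lambda>k. nat (- k)" "\<lambda>n. - int n", THEN iffD1, OF _ _ _ _ _ refl S'])
        (auto simp: even)
    have "(UNIV :: int set) = {0..} \<union> {..<0}" by auto
    then show ?thesis
      using has_sum_Un_disjoint[OF pos neg] by (auto simp: S_def disjoint_iff)
  qed
  show "g summable_on UNIV \<longleftrightarrow> summable (\<lambda>n. g (int n))"
  proof
    assume "g summable_on UNIV"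
    then have "g summable_on range int" by (rule summable_on_subset_banach) simp
    then show "summable (\<lambda>n. g (int n))"
      by (subst (asm) summable_on_reindex) (auto simp: o_def intro: summable_on_imp_summable)
  next
    assume "summable (\<lambda>n. g (int n))"
    from has_sum_imp_summable[OF *[OF this]] show "g summable_on UNIV" .
  qed
  show "summable (\<lambda>n. g (int n)) \<Longrightarrow> infsum g UNIV = 2 * (\<Sum>n. g (int n))"
    using * by (rule infsumI)
qed

definition sobolev_weight :: "real \<Rightarrow> nat \<Rightarrow> real" where
  "sobolev_weight s k = (1 + (real k)\<^sup>2) powr s"

lemma sobolev_weight_ge_1: "s \<ge> 0 \<Longrightarrow> 1 \<le> sobolev_weight s k"
  unfolding sobolev_weight_def by (rule ge_one_powr_ge_zero) auto

lemma sobolev_weight_nonneg [simp]: "0 \<le> sobolev_weight s k"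
  by (simp add: sobolev_weight_def)

lemma sobolev_weight_pos [simp]: "0 < sobolev_weight s k"
  using add_pos_nonneg[of 1 "(real k)\<^sup>2"] by (simp add: sobolev_weight_def)

lemma Hs_sum_odd:
  assumes u: "odd_integrable u"
  shows "(\<lambda>k::int. (1 + (real_of_int k)\<^sup>2) powr s * (cmod (fourier_coeff u k))\<^sup>2) summable_on UNIV
      \<longleftrightarrow> summable (\<lambda>k. sobolev_weight s k * (sine_coeff u k)\<^sup>2)" (is ?A)
    and "summable (\<lambda>k. sobolev_weight s k * (sine_coeff u k)\<^sup>2) \<Longrightarrow>
      (Hs_norm s u)\<^sup>2 = pi * (\<Sum>k. sobolev_weight s k * (sine_coeff u k)\<^sup>2)" (is "PROP ?B")
proof -
  define g where "g k = (1 + (real_of_int k)\<^sup>2) powr s * (cmod (fourier_coeff u k))\<^sup>2" for k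
  have c: "(cmod (fourier_coeff u k))\<^sup>2 = (of_int (sgn k) * sine_coeff u (nat \<bar>k\<bar>))\<^sup>2 / 4" for k
    by (simp add: fourier_coeff_odd[OF u] cmod_def power_divide)
  have gn: "(\<lambda>n. g (int n)) = (\<lambda>n. (sobolev_weight s n * (sine_coeff u n)\<^sup>2) / 4)"
  proof
    fix n show "g (int n) = (sobolev_weight s n * (sine_coeff u n)\<^sup>2) / 4"
      by (cases "n = 0") (auto simp: g_def c sobolev_weight_def)
  qed
  have g: "g 0 = 0" "\<And>k. 0 \<le> g k" "\<And>k. g (- k) = g k"
    by (simp_all add: g_def c sgn_minus power_mult_distrib)
  note e = even_int_sum[of g, OF g]
  show ?A using e(1) unfolding gn unfolding g_def by (simp only: summable_divide_iff) simp
  assume s: "summable (\<lambda>k. sobolev_weight s k * (sine_coeff u k)\<^sup>2)"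
  have "infsum g UNIV = 2 * (\<Sum>n. (sobolev_weight s n * (sine_coeff u n)\<^sup>2) / 4)"
    using e(2) s unfolding gn by (simp only: summable_divide)
  also have "\<dots> = (\<Sum>n. sobolev_weight s n * (sine_coeff u n)\<^sup>2) / 2"
    using s by (subst suminf_divide) auto
  finally have I: "infsum g UNIV = (\<Sum>n. sobolev_weight s n * (sine_coeff u n)\<^sup>2) / 2" .
  have "0 \<le> (\<Sum>n. sobolev_weight s n * (sine_coeff u n)\<^sup>2)"
    using s by (intro suminf_nonneg) auto
  then show "(Hs_norm s u)\<^sup>2 = pi * (\<Sum>k. sobolev_weight s k * (sine_coeff u k)\<^sup>2)"
    using I unfolding Hs_norm_def g_def by simp
qed

lemma Hs_per_odd_iff:
  "u \<in> Hs_per_odd s \<longleftrightarrow> periodic_2pi u \<and> square_integrable u \<and> (AE x in lborel. u (- x) = - u x) \<and>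
     summable (\<lambda>k. sobolev_weight s k * (sine_coeff u k)\<^sup>2)"
proof -
  have "odd_integrable u" if "square_integrable u" "AE x in lborel. u (- x) = - u x"
    using that by (intro square_integrable_odd_integrable AE_circI)
  then show ?thesis
    unfolding Hs_per_odd_def Hs_per_def set_integrable_circ
    using Hs_sum_odd(1)[of u s] by (auto simp: square_integrable_def)
qed

lemma Hs_per_oddD:
  assumes "u \<in> Hs_per_odd s"
  shows "periodic_2pi u" "square_integrable u" "AE x in lborel. u (- x) = - u x"
    "AE x in circ. u (- x) = - u x" "odd_integrable u"
    "summable (\<lambda>k. sobolev_weight s k * (sine_coeff u k)\<^sup>2)"
  using assms square_integrable_odd_integrable AE_circI[of "\<lambda>x. u (- x) = - u x"] by (auto simp: Hs_per_odd_iff)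

lemma summable_le_sobolev_weight:
  assumes "s \<ge> 0" "summable (\<lambda>k. sobolev_weight s k * (b k)\<^sup>2)"
  shows "summable (\<lambda>k. (b k)\<^sup>2)"
proof (rule summable_comparison_test'[OF assms(2), of 0])
  fix k
  show "norm ((b k)\<^sup>2) \<le> sobolev_weight s k * (b k)\<^sup>2"
    using mult_right_mono[OF sobolev_weight_ge_1[OF assms(1), of k], of "(b k)\<^sup>2"] by simp
qed

lemma Y_set_iff:
  assumes "s \<ge> 0"
  shows "u \<in> Y_set s \<tau> \<longleftrightarrow> u \<in> Hs_per_odd s \<and> pi * (\<Sum>k. (sine_coeff u k)\<^sup>2) = \<tau>"
proof -
  have "(L2_norm_per u)\<^sup>2 = pi * (\<Sum>k. (sine_coeff u k)\<^sup>2)" if "u \<in> Hs_per_odd s"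
  proof -
    have "sobolev_weight 0 k = 1" for k
      using sobolev_weight_pos[of 1 k] by (simp add: sobolev_weight_def)
    then show ?thesis
      using Hs_sum_odd(2)[OF Hs_per_oddD(5)[OF that], of 0]
        summable_le_sobolev_weight[OF assms Hs_per_oddD(6)[OF that]] by simp
  qed
  then show ?thesis by (auto simp: Y_set_def)
qed

lemma powr_le_sobolev_weight:
  assumes "s \<ge> 0"
  shows "real k powr (2 * s) \<le> sobolev_weight s k"
proof -
  have "real k powr (2 * s) = ((real k)\<^sup>2) powr s"
    by (simp add: powr_powr[symmetric] powr_numeral)
  also have "\<dots> \<le> sobolev_weight s k"
    unfolding sobolev_weight_def using assms by (intro powr_mono2) auto
  finally show ?thesis .
qed

lemma Hs_kinetic_summable:
  assumes "s \<ge> 0" "summable (\<lambda>k. sobolev_weight s k * (b k)\<^sup>2)"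
  shows "summable (\<lambda>k. real k powr (2 * s) * (b k)\<^sup>2)"
  by (rule summable_comparison_test'[OF assms(2), of 0])
    (simp add: mult_right_mono powr_le_sobolev_weight[OF assms(1)])

lemma L1_per_iff: "f \<in> L1_per \<longleftrightarrow> periodic_2pi f \<and> f \<in> borel_measurable borel \<and> integrable circ f"
  by (simp add: L1_per_def set_integrable_circ)

lemma has_frac_laplacian_unique:
  assumes "has_frac_laplacian s V W" "has_frac_laplacian s V W'"
  shows "AE x in circ. W x = W' x"
  using assms by (intro fourier_coeff_determines) (auto simp: has_frac_laplacian_def L1_per_iff)

lemma has_frac_laplacian_odd:
  assumes "periodic_2pi V" "odd_integrable V" "periodic_2pi W" "odd_integrable W"
    and c: "\<And>k. sine_coeff W k = real k powr (2 * s) * sine_coeff V k"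
  shows "has_frac_laplacian s V W"
  unfolding has_frac_laplacian_def
proof (intro conjI allI)
  show "V \<in> L1_per" "W \<in> L1_per" using assms by (auto simp: L1_per_iff odd_integrable_def)
  fix k :: int
  have "real (nat \<bar>k\<bar>) = \<bar>real_of_int k\<bar>" by simp
  then show "fourier_coeff W k = complex_of_real (\<bar>real_of_int k\<bar> powr (2 * s)) * fourier_coeff V k"
    using assms by (simp add: fourier_coeff_odd c complex_eq_iff)
qed

text \<open>
  Makes the choice operator in \<open>frac_laplacian\<close> harmless: any witness agrees with the chosen
  representative up to a null set.
\<close>

lemma frac_laplacian_AE:
  assumes "has_frac_laplacian s V W"
  shows "has_frac_laplacian s V (frac_laplacian s V)" "AE x in circ. frac_laplacian s V x = W x"
proof -
  show *: "has_frac_laplacian s V (frac_laplacian s V)"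
    unfolding frac_laplacian_def by (rule someI[of "has_frac_laplacian s V"]) (rule assms)
  show "AE x in circ. frac_laplacian s V x = W x"
    by (rule has_frac_laplacian_unique[OF * assms])
qed

definition kinetic :: "real \<Rightarrow> (real \<Rightarrow> real) \<Rightarrow> real" where
  "kinetic s u = pi * (\<Sum>k. real k powr (2 * s) * (sine_coeff u k)\<^sup>2)"

text \<open>
  Riesz--Fischer supplies a square integrable \<open>W\<close> with coefficients \<open>k\<^sup>s b\<^sub>k\<close>, which must be
  \<open>(-\<Delta>)\<^bsup>s/2\<^esup> u\<close>, and Parseval's identity for \<open>W\<close> gives the quadratic part.
\<close>

lemma energy_eq:
  assumes s: "s \<ge> 0" and u: "u \<in> Hs_per_odd s" and u4: "integrable circ (\<lambda>x. (u x)^4)"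
  shows "energy s u = kinetic s u / 2 + integral\<^sup>L circ (\<lambda>x. (u x)^4) / 4"
proof -
  define c where "c k = real k powr s * sine_coeff u k" for k
  have c0: "c 0 = 0" by (simp add: c_def)
  have c2: "(c k)\<^sup>2 = real k powr (2 * s) * (sine_coeff u k)\<^sup>2" for k
    by (simp add: c_def power_mult_distrib powr_powr[symmetric] powr_numeral power2_eq_square
        powr_add[symmetric])
  have sc: "summable (\<lambda>k. (c k)\<^sup>2)"
    unfolding c2 by (rule Hs_kinetic_summable[OF s Hs_per_oddD(6)[OF u]])
  obtain W where W: "periodic_2pi W" "\<And>x. W (- x) = - W x" "L2_tendsto (sine_poly c) W"
    using Riesz_Fischer_sine[OF c0 sc] by blast
  have Wsq: "square_integrable W" using W(3) by (simp add: L2_tendsto_def)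
  then have Wodd: "odd_integrable W" using W(2) by (intro square_integrable_odd_integrable) auto
  have "has_frac_laplacian (s / 2) u W"
    using L2_tendsto_sine_poly(1)[of c W, OF c0 W(3)] Hs_per_oddD[OF u] W Wodd
    by (intro has_frac_laplacian_odd) (auto simp: c_def)
  from frac_laplacian_AE[OF this]
  have fl: "has_frac_laplacian (s / 2) u (frac_laplacian (s / 2) u)"
    "AE x in circ. frac_laplacian (s / 2) u x = W x" .
  have m: "frac_laplacian (s / 2) u \<in> borel_measurable borel" "u \<in> borel_measurable borel"
    using fl(1) by (auto simp: has_frac_laplacian_def L1_per_iff)
  have "integral\<^sup>L circ (\<lambda>x. (frac_laplacian (s / 2) u x)\<^sup>2 + 1/2 * (u x)^4)
     = integral\<^sup>L circ (\<lambda>x. (W x)\<^sup>2 + 1/2 * (u x)^4)"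
    using m square_integrableD(1)[OF Wsq]
    by (intro integral_cong_AE measurable_circ eventually_mono[OF fl(2)]) auto
  also have "\<dots> = integral\<^sup>L circ (\<lambda>x. (W x)\<^sup>2) + 1/2 * integral\<^sup>L circ (\<lambda>x. (u x)^4)"
    using u4 square_integrableD(3)[OF Wsq] by simp
  also have "integral\<^sup>L circ (\<lambda>x. (W x)\<^sup>2) = kinetic s u"
    using L2_tendsto_sine_poly(2)[of c W, OF c0 W(3)] by (simp add: c2 kinetic_def)
  finally show ?thesis by (simp add: energy_def set_integral_circ)
qed

section \<open>The embedding into the fourth power space\<close>

lemma sum_symmetric_interval:
  fixes f :: "int \<Rightarrow> real"
  shows "(\<Sum>j\<in>{- int N<..<int N}. f j) =
    (\<Sum>k<N. f (int k) + f (- int k)) - (if N = 0 then 0 else f 0)"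
proof (induction N)
  case (Suc N)
  show ?case
  proof (cases "N = 0")
    case True
    have "{- int (Suc 0)<..<int (Suc 0)} = {0}" by auto
    then show ?thesis using True by simp
  next
    case False
    then have "{- int (Suc N)<..<int (Suc N)} = insert (int N) (insert (- int N) {- int N<..<int N})"
      by auto
    then show ?thesis using Suc False by simp
  qed
qed simp

lemma sum_abs_le_twice:
  assumes F: "\<And>j. j \<in> F \<Longrightarrow> \<bar>j\<bar> < int N" and h: "\<And>k. 0 \<le> (h k :: real)"
  shows "(\<Sum>j\<in>F. h (nat \<bar>j\<bar>)) \<le> 2 * (\<Sum>k<N. h k)"
proof -
  have "F \<subseteq> {- int N<..<int N}" using F by (force simp: abs_less_iff)
  then have "(\<Sum>j\<in>F. h (nat \<bar>j\<bar>)) \<le> (\<Sum>j\<in>{- int N<..<int N}. h (nat \<bar>j\<bar>))"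
    using h by (intro sum_mono2) auto
  also have "\<dots> \<le> 2 * (\<Sum>k<N. h k)"
    using h unfolding sum_symmetric_interval by (simp add: sum_distrib_left)
  finally show ?thesis .
qed

lemma integral_circ_cos_cos:
  "integral\<^sup>L circ (\<lambda>x. cos (of_int n * x) * cos (of_int m * x))
     = pi * ((if n = m then 1 else 0) + (if n = - m then 1 else 0))"
proof -
  have "cos (of_int n * x) * cos (of_int m * x)
     = cos (of_int (n - m) * x) / 2 + cos (of_int (n + m) * x) / 2" for x :: real
    by (simp add: left_diff_distrib distrib_right cos_diff cos_add add_divide_distrib diff_divide_distrib)
  then have "integral\<^sup>L circ (\<lambda>x. cos (of_int n * x) * cos (of_int m * x))
     = integral\<^sup>L circ (\<lambda>x. cos (of_int (n - m) * x)) / 2 + integral\<^sup>L circ (\<lambda>x. cos (of_int (n + m) * x)) / 2"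
    by (simp only:) (subst Bochner_Integration.integral_add, simp_all only: integrable_circ_cos
        integrable_divide integral_divide_zero)
  then show ?thesis unfolding integral_circ_cos by auto
qed

lemma integrable_circ_cos_cos: "integrable circ (\<lambda>x. cos (a * x) * cos (b * x))"
  by (intro square_integrable_mult square_integrable_bounded[of _ 1]) auto

text \<open>
  Cosines with frequencies \<open>n\<close> and \<open>m\<close> are orthogonal unless \<open>n = m\<close> or \<open>n = - m\<close>; the second
  case is absorbed by \<open>2 c\<^sub>n c\<^sub>m \<le> c\<^sub>n\<^sup>2 + c\<^sub>m\<^sup>2\<close> and accounts for the factor \<open>2\<close>.
\<close>

lemma integral_cosine_poly_square_le:
  fixes c :: "int \<Rightarrow> real"
  assumes B: "finite B"
  shows "integral\<^sup>L circ (\<lambda>x. (\<Sum>n\<in>B. c n * cos (of_int n * x))\<^sup>2) \<le> 2 * pi * (\<Sum>n\<in>B. (c n)\<^sup>2)"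
proof -
  have "integral\<^sup>L circ (\<lambda>x. (\<Sum>n\<in>B. c n * cos (of_int n * x))\<^sup>2)
      = integral\<^sup>L circ (\<lambda>x. \<Sum>n\<in>B. \<Sum>m\<in>B. (c n * c m) * (cos (of_int n * x) * cos (of_int m * x)))"
    by (simp add: power2_eq_square sum_product mult_ac)
  also have "\<dots> = (\<Sum>n\<in>B. \<Sum>m\<in>B. (c n * c m) * (pi * ((if n = m then 1 else 0) + (if n = - m then 1 else 0))))"
    by (simp add: integrable_circ_cos_cos integral_circ_cos_cos)
  also have "\<dots> \<le> (\<Sum>n\<in>B. \<Sum>m\<in>B. pi * ((if n = m then (c n)\<^sup>2 else 0) +
       ((if n = - m then (c n)\<^sup>2 else 0) + (if n = - m then (c m)\<^sup>2 else 0)) / 2))"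
  proof (intro sum_mono)
    fix n m
    have "0 \<le> (c n - c m)\<^sup>2" by simp
    then have "c n * c m \<le> ((c n)\<^sup>2 + (c m)\<^sup>2) / 2" by (simp add: power2_diff)
    then have "c n * c m * ((if n = m then 1 else 0) + (if n = - m then 1 else 0))
      \<le> (if n = m then (c n)\<^sup>2 else 0) +
       ((if n = - m then (c n)\<^sup>2 else 0) + (if n = - m then (c m)\<^sup>2 else 0)) / 2"
      by (auto simp: power2_eq_square)
    from mult_left_mono[OF this, of pi]
    show "(c n * c m) * (pi * ((if n = m then 1 else 0) + (if n = - m then 1 else 0)))
      \<le> pi * ((if n = m then (c n)\<^sup>2 else 0) +
       ((if n = - m then (c n)\<^sup>2 else 0) + (if n = - m then (c m)\<^sup>2 else 0)) / 2)"
      by (simp only: mult.left_commute pi_ge_zero)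
  qed
  also have "\<dots> = pi * ((\<Sum>n\<in>B. \<Sum>m\<in>B. if n = m then (c n)\<^sup>2 else 0) +
      ((\<Sum>n\<in>B. \<Sum>m\<in>B. if n = - m then (c n)\<^sup>2 else 0) + (\<Sum>n\<in>B. \<Sum>m\<in>B. if n = - m then (c m)\<^sup>2 else 0)) / 2)"
    by (simp only: sum_distrib_left[symmetric] sum.distrib sum_divide_distrib[symmetric])
  also have "\<dots> \<le> pi * ((\<Sum>n\<in>B. (c n)\<^sup>2) + ((\<Sum>n\<in>B. (c n)\<^sup>2) + (\<Sum>n\<in>B. (c n)\<^sup>2)) / 2)"
  proof (intro mult_left_mono add_mono divide_right_mono)
    show "(\<Sum>n\<in>B. \<Sum>m\<in>B. if n = m then (c n)\<^sup>2 else 0) \<le> (\<Sum>n\<in>B. (c n)\<^sup>2)"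
      using B by simp
    show "(\<Sum>n\<in>B. \<Sum>m\<in>B. if n = - m then (c n)\<^sup>2 else 0) \<le> (\<Sum>n\<in>B. (c n)\<^sup>2)"
    proof (intro sum_mono)
      fix n
      have "(\<Sum>m\<in>B. if n = - m then (c n)\<^sup>2 else 0) = (\<Sum>m\<in>B. if m = - n then (c n)\<^sup>2 else 0)"
        by (intro sum.cong) auto
      then show "(\<Sum>m\<in>B. if n = - m then (c n)\<^sup>2 else 0) \<le> (c n)\<^sup>2" using B by simp
    qed
    show "(\<Sum>n\<in>B. \<Sum>m\<in>B. if n = - m then (c m)\<^sup>2 else 0) \<le> (\<Sum>m\<in>B. (c m)\<^sup>2)"
      by (subst sum.swap, intro sum_mono) (use B in simp)
  qed auto
  finally show ?thesis by (simp add: mult_ac)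
qed

text \<open>
  Each entry of the convolution is estimated by Cauchy--Schwarz after inserting
  \<open>(w\<^sub>j w\<^sub>n\<^sub>-\<^sub>j)\<^bsup>1/2\<^esup>\<close> and its inverse. The factor \<open>\<Sum>\<^sub>j 1 / (w\<^sub>j w\<^sub>n\<^sub>-\<^sub>j)\<close> is at most \<open>K\<close> uniformly in
  \<open>n\<close>, and the remaining double sum over \<open>n\<close> and \<open>j\<close> factorises.
\<close>

lemma convolution_weighted_bound:
  fixes \<beta> w :: "int \<Rightarrow> real"
  assumes A: "finite A" and \<beta>: "\<And>j. j \<notin> A \<Longrightarrow> \<beta> j = 0"
    and w: "\<And>j. 0 < w j"
    and K: "\<And>F. finite F \<Longrightarrow> (\<Sum>j\<in>F. 1 / (w j)\<^sup>2) \<le> K"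
    and B: "finite B"
  shows "(\<Sum>n\<in>B. (\<Sum>j\<in>A. \<beta> j * \<beta> (n - j))\<^sup>2) \<le> K * (\<Sum>j\<in>A. w j * (\<beta> j)\<^sup>2)\<^sup>2"
proof -
  define G where "G j = w j * (\<beta> j)\<^sup>2" for j
  have G0: "0 \<le> G j" for j using less_imp_le[OF w] by (simp add: G_def)
  have K0: "0 \<le> K" using K[of "{}"] by simp
  have c: "(\<Sum>j\<in>A. \<beta> j * \<beta> (n - j))\<^sup>2 \<le> K * (\<Sum>j\<in>A. G j * G (n - j))" for n
  proof -
    define v where "v j = 1 / sqrt (w j * w (n - j))" for j
    have w': "0 < w j * w (n - j)" for j using w by simp
    have "(\<Sum>j\<in>A. \<beta> j * \<beta> (n - j))\<^sup>2 = (\<Sum>j\<in>A. v j * (sqrt (w j * w (n - j)) * (\<beta> j * \<beta> (n - j))))\<^sup>2"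
    proof -
      have "v j * (sqrt (w j * w (n - j)) * q) = q" for j q
        using w'[of j] by (auto simp: v_def simp del: real_sqrt_mult)
      then show ?thesis by (simp only:)
    qed
    also have "\<dots> \<le> (\<Sum>j\<in>A. (v j)\<^sup>2) * (\<Sum>j\<in>A. (sqrt (w j * w (n - j)) * (\<beta> j * \<beta> (n - j)))\<^sup>2)"
      by (rule Cauchy_Schwarz_ineq_sum)
    also have "(\<Sum>j\<in>A. (sqrt (w j * w (n - j)) * (\<beta> j * \<beta> (n - j)))\<^sup>2) = (\<Sum>j\<in>A. G j * G (n - j))"
      using less_imp_le[OF w'] by (intro sum.cong) (simp_all add: power_mult_distrib G_def del: real_sqrt_mult)
    also have "(\<Sum>j\<in>A. (v j)\<^sup>2) \<le> (\<Sum>j\<in>A. (1 / (w j)\<^sup>2 + 1 / (w (n - j))\<^sup>2) / 2)"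
    proof (intro sum_mono)
      fix j
      have "0 \<le> (1 / w j - 1 / w (n - j))\<^sup>2" by simp
      then have "1 / (w j * w (n - j)) \<le> (1 / (w j)\<^sup>2 + 1 / (w (n - j))\<^sup>2) / 2"
        by (simp add: power2_diff power_divide)
      then show "(v j)\<^sup>2 \<le> (1 / (w j)\<^sup>2 + 1 / (w (n - j))\<^sup>2) / 2"
        using less_imp_le[OF w'] by (simp add: v_def power_divide del: real_sqrt_mult)
    qed
    also have "\<dots> = ((\<Sum>j\<in>A. 1 / (w j)\<^sup>2) + (\<Sum>j\<in>A. 1 / (w (n - j))\<^sup>2)) / 2"
      by (simp add: sum.distrib sum_divide_distrib[symmetric])
    also have "(\<Sum>j\<in>A. 1 / (w (n - j))\<^sup>2) = (\<Sum>j\<in>(\<lambda>j. n - j) ` A. 1 / (w j)\<^sup>2)"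
      by (subst sum.reindex) (auto simp: inj_on_def)
    also have "((\<Sum>j\<in>A. 1 / (w j)\<^sup>2) + \<dots>) / 2 \<le> K"
      using K[OF A] K[of "(\<lambda>j. n - j) ` A"] A by simp
    finally show ?thesis
      by (simp add: mult_right_mono sum_nonneg G0)
  qed
  have "(\<Sum>n\<in>B. (\<Sum>j\<in>A. \<beta> j * \<beta> (n - j))\<^sup>2) \<le> (\<Sum>n\<in>B. K * (\<Sum>j\<in>A. G j * G (n - j)))"
    by (intro sum_mono c)
  also have "\<dots> = K * (\<Sum>j\<in>A. G j * (\<Sum>n\<in>B. G (n - j)))"
    unfolding sum_distrib_left[symmetric] by (subst sum.swap) (simp add: sum_distrib_left)
  also have "\<dots> \<le> K * (\<Sum>j\<in>A. G j * (\<Sum>i\<in>A. G i))"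
  proof (intro mult_left_mono sum_mono G0 K0)
    fix j
    have "(\<Sum>n\<in>B. G (n - j)) = (\<Sum>i\<in>(\<lambda>n. n - j) ` B. G i)"
      by (subst sum.reindex) (auto simp: inj_on_def)
    also have "\<dots> = (\<Sum>i\<in>(\<lambda>n. n - j) ` B \<inter> A. G i)"
      using B \<beta> by (intro sum.mono_neutral_right) (auto simp: G_def)
    also have "\<dots> \<le> (\<Sum>i\<in>A. G i)" using A G0 by (intro sum_mono2) auto
    finally show "(\<Sum>n\<in>B. G (n - j)) \<le> (\<Sum>i\<in>A. G i)" .
  qed
  also have "\<dots> = K * (\<Sum>j\<in>A. G j)\<^sup>2" by (simp add: power2_eq_square sum_distrib_right)
  finally show ?thesis by (simp add: G_def)
qed

lemma sobolev_weight_inverse_square_summable: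
  assumes "1/4 < s"
  shows "summable (\<lambda>k. 1 / (sobolev_weight s k)\<^sup>2)"
proof (rule summable_comparison_test')
  show "summable (\<lambda>k. real k powr (- 4 * s))" using assms by (simp add: summable_real_powr_iff)
  fix k :: nat assume k: "k \<ge> 1"
  have "real k powr (2 * s) \<le> sobolev_weight s k" using assms by (intro powr_le_sobolev_weight) auto
  then have "(real k powr (2 * s))\<^sup>2 \<le> (sobolev_weight s k)\<^sup>2" by (intro power_mono) auto
  moreover have "(real k powr (2 * s))\<^sup>2 = real k powr (4 * s)"
    by (simp add: power2_eq_square powr_add[symmetric])
  moreover have "0 < real k powr (4 * s)" using k by simp
  ultimately have "1 / (sobolev_weight s k)\<^sup>2 \<le> 1 / real k powr (4 * s)"
    by (intro frac_le) auto
  then show "norm (1 / (sobolev_weight s k)\<^sup>2) \<le> real k powr (- 4 * s)"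
    by (simp add: powr_minus_divide)
qed

text \<open>
  Extending \<open>b\<close> to an odd sequence \<open>\<beta>\<close> on the integers, \<open>\<Sum> \<beta>\<^sub>j sin(j x) = 2 p(x)\<close> and
  \<open>\<Sum> \<beta>\<^sub>j cos(j x) = 0\<close>. By the addition theorem, \<open>\<Sum>\<Sum> \<beta>\<^sub>j \<beta>\<^sub>l cos((j + l) x)\<close> is the difference of
  the squares of the cosine and the sine sum, hence \<open>- 4 p(x)\<^sup>2\<close>.
\<close>

lemma sine_poly_square_eq:
  fixes b :: "nat \<Rightarrow> real" and N :: nat
  defines "A \<equiv> {- int N<..<int N}" and "B \<equiv> {- 2 * int N<..<2 * int N}"
    and "\<beta> \<equiv> (\<lambda>j. if \<bar>j\<bar> < int N then of_int (sgn j) * b (nat \<bar>j\<bar>) else 0)"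
  assumes b0: "b 0 = 0"
  shows "- 4 * (sine_poly b N x)\<^sup>2 = (\<Sum>n\<in>B. (\<Sum>j\<in>A. \<beta> j * \<beta> (n - j)) * cos (of_int n * x))"
proof -
  have \<beta>0: "\<beta> 0 = 0" by (simp add: \<beta>_def)
  have \<beta>k: "\<beta> (int k) = b k" "\<beta> (- int k) = - b k" if "k < N" for k
    using that b0 by (cases "k = 0"; simp add: \<beta>_def)+
  have s: "(\<Sum>j\<in>A. \<beta> j * sin (of_int j * x)) = 2 * sine_poly b N x"
    unfolding A_def sum_symmetric_interval sine_poly_def
    by (simp add: \<beta>k sum_distrib_left)
  have c: "(\<Sum>j\<in>A. \<beta> j * cos (of_int j * x)) = 0"
    unfolding A_def sum_symmetric_interval
    by (simp add: \<beta>k \<beta>0)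
  have "(\<Sum>n\<in>B. (\<Sum>j\<in>A. \<beta> j * \<beta> (n - j)) * cos (of_int n * x))
     = (\<Sum>j\<in>A. \<Sum>n\<in>B. \<beta> j * \<beta> (n - j) * cos (of_int n * x))"
    by (subst sum.swap) (simp add: sum_distrib_right)
  also have "\<dots> = (\<Sum>j\<in>A. \<Sum>l\<in>A. \<beta> j * \<beta> l * cos (of_int (j + l) * x))"
  proof (rule sum.cong[OF refl])
    fix j assume j: "j \<in> A"
    have "(\<Sum>l\<in>A. \<beta> j * \<beta> l * cos (of_int (j + l) * x))
       = (\<Sum>n\<in>(\<lambda>l. j + l) ` A. \<beta> j * \<beta> (n - j) * cos (of_int n * x))"
      by (subst sum.reindex) (auto simp: inj_on_def)
    also have "\<dots> = (\<Sum>n\<in>B. \<beta> j * \<beta> (n - j) * cos (of_int n * x))"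
    proof (rule sum.mono_neutral_left)
      show "(\<lambda>l. j + l) ` A \<subseteq> B" using j by (auto simp: A_def B_def)
      show "\<forall>i\<in>B - (\<lambda>l. j + l) ` A. \<beta> j * \<beta> (i - j) * cos (of_int i * x) = 0"
      proof
        fix i assume "i \<in> B - (\<lambda>l. j + l) ` A"
        then have "i - j \<notin> A" by (metis DiffD2 add.commute diff_add_cancel image_eqI)
        then have "\<beta> (i - j) = 0" by (auto simp: A_def \<beta>_def abs_less_iff)
        then show "\<beta> j * \<beta> (i - j) * cos (of_int i * x) = 0" by simp
      qed
    qed (simp add: B_def)
    finally show "(\<Sum>n\<in>B. \<beta> j * \<beta> (n - j) * cos (of_int n * x))
        = (\<Sum>l\<in>A. \<beta> j * \<beta> l * cos (of_int (j + l) * x))" by simp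
  qed
  also have "\<dots> = (\<Sum>j\<in>A. \<beta> j * cos (of_int j * x))\<^sup>2 - (\<Sum>j\<in>A. \<beta> j * sin (of_int j * x))\<^sup>2"
    by (simp add: power2_eq_square sum_product sum_subtractf[symmetric] distrib_right cos_add algebra_simps)
  also have "\<dots> = - 4 * (sine_poly b N x)\<^sup>2" by (simp add: s c power_mult_distrib)
  finally show ?thesis by simp
qed

text \<open>
  The constant on the right is uniform in the length \<open>N\<close>, so that the bound passes to limits.
\<close>

lemma sine_poly_L4_bound:
  assumes s: "1/4 < s" and b0: "b 0 = 0"
  shows "integral\<^sup>L circ (\<lambda>x. (sine_poly b N x)^4) \<le>
    pi * (\<Sum>k. 1 / (sobolev_weight s k)\<^sup>2) * (\<Sum>k<N. sobolev_weight s k * (b k)\<^sup>2)\<^sup>2"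
proof -
  define A B where "A = {- int N<..<int N}" and "B = {- 2 * int N<..<2 * int N}"
  define \<beta> where "\<beta> = (\<lambda>j::int. if \<bar>j\<bar> < int N then of_int (sgn j) * b (nat \<bar>j\<bar>) else 0)"
  define w where "w j = sobolev_weight s (nat \<bar>j\<bar>)" for j :: int
  define K where "K = (\<Sum>k. 1 / (sobolev_weight s k)\<^sup>2)"
  define T where "T = (\<Sum>k<N. sobolev_weight s k * (b k)\<^sup>2)"
  define c where "c n = (\<Sum>j\<in>A. \<beta> j * \<beta> (n - j))" for n
  note sK = sobolev_weight_inverse_square_summable[OF s]
  have K: "(\<Sum>j\<in>F. 1 / (w j)\<^sup>2) \<le> 2 * K" if "finite F" for F
  proof -
    have "finite ((\<lambda>j. nat \<bar>j\<bar>) ` F)" using that by simp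
    then obtain M where "\<forall>n \<in> (\<lambda>j. nat \<bar>j\<bar>) ` F. n < M"
      unfolding finite_nat_set_iff_bounded by blast
    then have "(\<Sum>j\<in>F. 1 / (w j)\<^sup>2) \<le> 2 * (\<Sum>k<M. 1 / (sobolev_weight s k)\<^sup>2)"
      unfolding w_def by (intro sum_abs_le_twice) force+
    also have "\<dots> \<le> 2 * K" unfolding K_def using sK by (intro mult_left_mono sum_le_suminf) auto
    finally show ?thesis .
  qed
  have K0: "0 \<le> K" using K[of "{}"] by simp
  have "w j * (\<beta> j)\<^sup>2 = (\<lambda>k. sobolev_weight s k * (b k)\<^sup>2) (nat \<bar>j\<bar>)" if "j \<in> A" for j
    using that b0 by (cases j "0::int" rule: linorder_cases) (auto simp: w_def \<beta>_def A_def)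
  then have "(\<Sum>j\<in>A. w j * (\<beta> j)\<^sup>2) = (\<Sum>j\<in>A. (\<lambda>k. sobolev_weight s k * (b k)\<^sup>2) (nat \<bar>j\<bar>))"
    by (intro sum.cong) auto
  also have "\<dots> \<le> 2 * T" unfolding T_def by (rule sum_abs_le_twice) (auto simp: A_def)
  finally have T: "(\<Sum>j\<in>A. w j * (\<beta> j)\<^sup>2) \<le> 2 * T" .
  have "16 * integral\<^sup>L circ (\<lambda>x. (sine_poly b N x)^4) = integral\<^sup>L circ (\<lambda>x. (- 4 * (sine_poly b N x)\<^sup>2)\<^sup>2)"
    by (simp add: power_mult_distrib flip: power_mult)
  also have "\<dots> = integral\<^sup>L circ (\<lambda>x. (\<Sum>n\<in>B. c n * cos (of_int n * x))\<^sup>2)"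
    unfolding sine_poly_square_eq[of b N, OF b0] c_def A_def B_def \<beta>_def ..
  also have "\<dots> \<le> 2 * pi * (\<Sum>n\<in>B. (c n)\<^sup>2)"
    by (rule integral_cosine_poly_square_le) (simp add: B_def)
  also have "(\<Sum>n\<in>B. (c n)\<^sup>2) \<le> 2 * K * (\<Sum>j\<in>A. w j * (\<beta> j)\<^sup>2)\<^sup>2"
    unfolding c_def
    by (rule convolution_weighted_bound) (auto simp: A_def B_def \<beta>_def w_def intro!: K[unfolded w_def])
  also have "(\<Sum>j\<in>A. w j * (\<beta> j)\<^sup>2)\<^sup>2 \<le> (2 * T)\<^sup>2"
    using T by (intro power_mono) (auto intro!: sum_nonneg simp: w_def)
  finally have "16 * integral\<^sup>L circ (\<lambda>x. (sine_poly b N x)^4) \<le> 2 * pi * (2 * K * (2 * T)\<^sup>2)"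
    using K0 by (simp add: mult_left_mono)
  then show ?thesis unfolding K_def[symmetric] T_def[symmetric] by (simp add: power_mult_distrib mult_ac)
qed

theorem Hs_embeds_L4:
  assumes s: "1/4 < s" and u: "u \<in> Hs_per_odd s"
  shows "integrable circ (\<lambda>x. (u x)^4)"
proof -
  define b where "b = sine_coeff u"
  define K where "K = (\<Sum>k. 1 / (sobolev_weight s k)\<^sup>2)"
  note u' = Hs_per_oddD[OF u]
  have K0: "0 \<le> K" unfolding K_def
    by (intro suminf_nonneg sobolev_weight_inverse_square_summable s) auto
  have "summable (\<lambda>k. (b k)\<^sup>2)"
    unfolding b_def using s by (intro summable_le_sobolev_weight[OF _ u'(6)]) auto
  then have lim: "L2_tendsto (sine_poly b) u"
    unfolding b_def by (intro sine_series_L2 u')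
  then obtain r where r: "strict_mono r" "AE x in circ. (\<lambda>n. sine_poly b (r n) x) \<longlonglongrightarrow> u x"
    by (rule L2_tendsto_AE_subseq)
  define T where "T = (\<Sum>k. sobolev_weight s k * (b k)\<^sup>2)"
  show ?thesis
  proof (rule Fatou_integral(1)[where h = "\<lambda>n x. (sine_poly b (r n) x)^4" and c = "\<lambda>_. pi * K * T\<^sup>2", OF _ _ _ _ _ _ tendsto_const])
    show "integrable circ (\<lambda>x. (sine_poly b (r n) x)^4)" for n
    proof -
      have "\<bar>sine_poly b (r n) x\<bar> \<le> (\<Sum>k<r n. \<bar>b k\<bar>)" for x
        unfolding sine_poly_def
        by (rule order_trans[OF sum_abs sum_mono]) (auto simp: abs_mult mult_left_le)
      then have "\<bar>(sine_poly b (r n) x)\<^sup>2\<bar> \<le> (\<Sum>k<r n. \<bar>b k\<bar>)\<^sup>2" for x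
        by (metis abs_ge_zero power_abs power_mono)
      then have "square_integrable (\<lambda>x. (sine_poly b (r n) x)\<^sup>2)"
        using square_integrableD(1)[OF square_integrable_sine_poly]
        by (intro square_integrable_bounded) auto
      then show ?thesis using square_integrableD(3) by (fastforce simp flip: power_mult)
    qed
    show "AE x in circ. (\<lambda>n. (sine_poly b (r n) x)^4) \<longlonglongrightarrow> (u x)^4"
      using r(2) by eventually_elim (rule tendsto_power)
    show "integral\<^sup>L circ (\<lambda>x. (sine_poly b (r n) x)^4) \<le> pi * K * T\<^sup>2" for n
    proof -
      have "integral\<^sup>L circ (\<lambda>x. (sine_poly b (r n) x)^4) \<le> pi * K * (\<Sum>k<r n. sobolev_weight s k * (b k)\<^sup>2)\<^sup>2"
        unfolding K_def by (rule sine_poly_L4_bound[OF s]) (simp add: b_def)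
      also have "\<dots> \<le> pi * K * T\<^sup>2"
        unfolding T_def using u'(6) K0
        by (intro mult_left_mono power_mono sum_le_suminf) (auto simp: b_def sum_nonneg)
      finally show ?thesis .
    qed
    show "(\<lambda>x. (u x)^4) \<in> borel_measurable circ"
      using square_integrableD(2)[OF u'(2)] by simp
  qed auto
qed

section \<open>Existence of a minimizer\<close>

lemma Fatou_series:
  fixes c :: "nat \<Rightarrow> nat \<Rightarrow> real"
  assumes c0: "\<And>n k. 0 \<le> c n k" and s: "\<And>n. summable (c n)"
    and lim: "\<And>k. (\<lambda>n. c n k) \<longlonglongrightarrow> d k"
    and bound: "\<And>n. (\<Sum>k. c n k) \<le> C n" and C: "C \<longlonglongrightarrow> L"
  shows "summable d" "(\<Sum>k. d k) \<le> L"
proof -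
  have d0: "0 \<le> d k" for k by (rule LIMSEQ_le_const[OF lim]) (use c0 in blast)
  have part: "(\<Sum>k<K. d k) \<le> L" for K
  proof (rule LIMSEQ_le[OF tendsto_sum[OF lim] C])
    have "(\<Sum>k<K. c n k) \<le> C n" for n
      using sum_le_suminf[OF s, of "{..<K}" n] c0 bound[of n] by fastforce
    then show "\<exists>N. \<forall>n\<ge>N. (\<Sum>k<K. c n k) \<le> C n" by blast
  qed
  show sd: "summable d" by (rule summableI_nonneg_bounded[OF d0 part])
  show "(\<Sum>k. d k) \<le> L" by (rule suminf_le_const[OF sd part])
qed

text \<open>
  The compactness of the embedding of \<open>H\<^sup>s\<close> into \<open>L\<^sup>2\<close> on the level of coefficients: the terms with
  \<open>k \<ge> N\<close> contribute at most \<open>N\<^bsup>-2s\<^esup> C\<close>, and the finitely many others converge.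
\<close>

lemma l2_convergence_of_weighted_bound:
  fixes d :: "nat \<Rightarrow> nat \<Rightarrow> real"
  assumes s: "s > 0" and lim: "\<And>k. (\<lambda>n. d n k) \<longlonglongrightarrow> 0"
    and sm: "\<And>n. summable (\<lambda>k. (d n k)\<^sup>2)" and sw: "\<And>n. summable (\<lambda>k. real k powr (2 * s) * (d n k)\<^sup>2)"
    and bound: "\<And>n. (\<Sum>k. real k powr (2 * s) * (d n k)\<^sup>2) \<le> C"
  shows "(\<lambda>n. \<Sum>k. (d n k)\<^sup>2) \<longlonglongrightarrow> 0"
proof (rule LIMSEQ_I)
  fix e :: real assume e: "e > 0"
  have "0 \<le> (\<Sum>k. real k powr (2 * s) * (d 0 k)\<^sup>2)" by (intro suminf_nonneg sw) auto
  then have C0: "0 \<le> C" using bound[of 0] by linarith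
  have "((\<lambda>N. real N powr (- 2 * s)) \<longlongrightarrow> 0) sequentially"
    using s by (intro tendsto_neg_powr filterlim_real_sequentially) auto
  then have "(\<lambda>N. real N powr (- 2 * s) * C) \<longlonglongrightarrow> 0" by (rule tendsto_mult_left_zero)
  then have "eventually (\<lambda>N. real N powr (- 2 * s) * C < e / 2) sequentially"
    using e by (intro order_tendstoD(2)) auto
  then have "eventually (\<lambda>N. real N powr (- 2 * s) * C < e / 2 \<and> 1 \<le> N) sequentially"
    using eventually_ge_at_top by (rule eventually_conj)
  then obtain N where N: "real N powr (- 2 * s) * C < e / 2" "1 \<le> N"
    by (auto simp: eventually_sequentially)
  have split: "(\<Sum>k. (d n k)\<^sup>2) \<le> (\<Sum>k<N. (d n k)\<^sup>2) + real N powr (- 2 * s) * C" for n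
  proof -
    have fin: "(\<lambda>k. if k \<in> {..<N} then (d n k)\<^sup>2 else 0) sums (\<Sum>k<N. (d n k)\<^sup>2)"
      by (rule sums_If_finite_set) simp
    have "(\<Sum>k. (d n k)\<^sup>2) \<le> (\<Sum>k. (if k \<in> {..<N} then (d n k)\<^sup>2 else 0)
         + real N powr (- 2 * s) * (real k powr (2 * s) * (d n k)\<^sup>2))"
    proof (rule suminf_le[OF _ sm])
      fix k
      show "(d n k)\<^sup>2 \<le> (if k \<in> {..<N} then (d n k)\<^sup>2 else 0)
         + real N powr (- 2 * s) * (real k powr (2 * s) * (d n k)\<^sup>2)"
      proof (cases "k < N")
        case False
        then have "real N powr (2 * s) \<le> real k powr (2 * s)" using s by (intro powr_mono2) auto
        then have "1 \<le> real N powr (- 2 * s) * real k powr (2 * s)"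
          using N(2) by (simp add: powr_minus field_simps)
        from mult_right_mono[OF this, of "(d n k)\<^sup>2"] False show ?thesis by (simp add: mult.assoc)
      qed simp
      show "summable (\<lambda>k. (if k \<in> {..<N} then (d n k)\<^sup>2 else 0)
         + real N powr (- 2 * s) * (real k powr (2 * s) * (d n k)\<^sup>2))"
        using sw by (intro summable_add summable_mult sums_summable[OF fin])
    qed
    also have "\<dots> = (\<Sum>k<N. (d n k)\<^sup>2) + real N powr (- 2 * s) * (\<Sum>k. real k powr (2 * s) * (d n k)\<^sup>2)"
      by (intro sums_unique[symmetric] sums_add fin sums_mult summable_sums sw)
    also have "\<dots> \<le> (\<Sum>k<N. (d n k)\<^sup>2) + real N powr (- 2 * s) * C"
      by (intro add_left_mono mult_left_mono bound) auto
    finally show ?thesis .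
  qed
  have "(\<lambda>n. \<Sum>k<N. (d n k)\<^sup>2) \<longlonglongrightarrow> (\<Sum>k<N. 0\<^sup>2)"
    by (intro tendsto_intros lim)
  then have "eventually (\<lambda>n. (\<Sum>k<N. (d n k)\<^sup>2) < e / 2) sequentially"
    using e by (intro order_tendstoD(2)) auto
  then obtain n0 where n0: "\<And>n. n \<ge> n0 \<Longrightarrow> (\<Sum>k<N. (d n k)\<^sup>2) < e / 2"
    by (auto simp: eventually_sequentially)
  have "norm ((\<Sum>k. (d n k)\<^sup>2) - 0) < e" if "n \<ge> n0" for n
  proof -
    have "0 \<le> (\<Sum>k. (d n k)\<^sup>2)" by (intro suminf_nonneg sm) auto
    then show ?thesis using split[of n] n0[OF that] N(1) by simp
  qed
  then show "\<exists>n0. \<forall>n\<ge>n0. norm ((\<Sum>k. (d n k)\<^sup>2) - 0) < e" by blast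
qed

lemma sine_coeff_add:
  assumes "square_integrable u" "square_integrable v"
  shows "sine_coeff (\<lambda>x. u x + v x) k = sine_coeff u k + sine_coeff v k"
  using assms by (simp add: sine_coeff_def distrib_right square_integrable_mult add_divide_distrib)

lemma sine_coeff_scale: "sine_coeff (\<lambda>x. c * u x) k = c * sine_coeff u k"
  by (simp add: sine_coeff_def mult.assoc)

lemma sine_coeff_diff:
  assumes "square_integrable u" "square_integrable v"
  shows "sine_coeff (\<lambda>x. u x - v x) k = sine_coeff u k - sine_coeff v k"
  using assms by (simp add: sine_coeff_def left_diff_distrib square_integrable_mult diff_divide_distrib)

lemma summable_weighted_square_add:
  fixes g a b :: "nat \<Rightarrow> real"
  assumes g: "\<And>k. 0 \<le> g k" and a: "summable (\<lambda>k. g k * (a k)\<^sup>2)" and b: "summable (\<lambda>k. g k * (b k)\<^sup>2)"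
  shows "summable (\<lambda>k. g k * (a k + b k)\<^sup>2)"
    "(\<Sum>k. g k * (a k + b k)\<^sup>2) \<le> 2 * (\<Sum>k. g k * (a k)\<^sup>2) + 2 * (\<Sum>k. g k * (b k)\<^sup>2)"
proof -
  have *: "g k * (a k + b k)\<^sup>2 \<le> 2 * (g k * (a k)\<^sup>2) + 2 * (g k * (b k)\<^sup>2)" for k
  proof -
    have "0 \<le> (a k - b k)\<^sup>2" by simp
    then have "(a k + b k)\<^sup>2 \<le> 2 * (a k)\<^sup>2 + 2 * (b k)\<^sup>2" by (simp add: power2_sum power2_diff)
    from mult_left_mono[OF this g[of k]] show ?thesis by (simp add: algebra_simps)
  qed
  have s: "summable (\<lambda>k. 2 * (g k * (a k)\<^sup>2) + 2 * (g k * (b k)\<^sup>2))"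
    by (intro summable_add summable_mult a b)
  show 1: "summable (\<lambda>k. g k * (a k + b k)\<^sup>2)"
    by (rule summable_comparison_test'[OF s, of 0]) (use * g in auto)
  have "(\<Sum>k. g k * (a k + b k)\<^sup>2) \<le> (\<Sum>k. 2 * (g k * (a k)\<^sup>2) + 2 * (g k * (b k)\<^sup>2))"
    by (rule suminf_le[OF * 1 s])
  also have "\<dots> = 2 * (\<Sum>k. g k * (a k)\<^sup>2) + 2 * (\<Sum>k. g k * (b k)\<^sup>2)"
    by (intro sums_unique[symmetric] sums_add sums_mult summable_sums a b)
  finally show "(\<Sum>k. g k * (a k + b k)\<^sup>2) \<le> 2 * (\<Sum>k. g k * (a k)\<^sup>2) + 2 * (\<Sum>k. g k * (b k)\<^sup>2)" .
qed

lemma Hs_per_odd_add: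
  assumes u: "u \<in> Hs_per_odd s" and v: "v \<in> Hs_per_odd s"
  shows "(\<lambda>x. u x + v x) \<in> Hs_per_odd s"
  unfolding Hs_per_odd_iff
proof (intro conjI)
  note u' = Hs_per_oddD[OF u] and v' = Hs_per_oddD[OF v]
  show "periodic_2pi (\<lambda>x. u x + v x)" using u'(1) v'(1) by (simp add: periodic_2pi_def)
  show "square_integrable (\<lambda>x. u x + v x)" by (rule square_integrable_add[OF u'(2) v'(2)])
  show "AE x in lborel. u (- x) + v (- x) = - (u x + v x)"
    using u'(3) v'(3) by eventually_elim simp
  show "summable (\<lambda>k. sobolev_weight s k * (sine_coeff (\<lambda>x. u x + v x) k)\<^sup>2)"
    unfolding sine_coeff_add[OF u'(2) v'(2)]
    by (rule summable_weighted_square_add(1)[OF _ u'(6) v'(6)]) simp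
qed

lemma Hs_per_odd_scale:
  assumes u: "u \<in> Hs_per_odd s"
  shows "(\<lambda>x. c * u x) \<in> Hs_per_odd s"
  unfolding Hs_per_odd_iff
proof (intro conjI)
  note u' = Hs_per_oddD[OF u]
  show "periodic_2pi (\<lambda>x. c * u x)" using u'(1) by (simp add: periodic_2pi_def)
  show "square_integrable (\<lambda>x. c * u x)" by (rule square_integrable_scale[OF u'(2)])
  show "AE x in lborel. c * u (- x) = - (c * u x)"
    using u'(3) by eventually_elim simp
  have "summable (\<lambda>k. c\<^sup>2 * (sobolev_weight s k * (sine_coeff u k)\<^sup>2))"
    by (rule summable_mult[OF u'(6)])
  then show "summable (\<lambda>k. sobolev_weight s k * (sine_coeff (\<lambda>x. c * u x) k)\<^sup>2)"
    by (simp add: sine_coeff_scale power_mult_distrib mult_ac)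
qed

lemma sine_coeff_sin: "sine_coeff (\<lambda>x. sin (real j * x)) k = (if j = k \<and> j \<noteq> 0 then 1 else 0)"
  by (simp add: sine_coeff_def integral_circ_sin_sin)

lemma sin_in_Hs_per_odd: "(\<lambda>x. sin (real k * x)) \<in> Hs_per_odd s"
  unfolding Hs_per_odd_iff
proof (intro conjI)
  show "periodic_2pi (\<lambda>x. sin (real k * x))"
    unfolding periodic_2pi_def by (simp only: sin_nat_periodic) simp
  show "summable (\<lambda>j. sobolev_weight s j * (sine_coeff (\<lambda>x. sin (real k * x)) j)\<^sup>2)"
    by (rule summable_finite[of "{k}"]) (auto simp: sine_coeff_sin)
qed auto

definition mass :: "(real \<Rightarrow> real) \<Rightarrow> real" where
  "mass u = pi * (\<Sum>k. (sine_coeff u k)\<^sup>2)"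

definition quartic :: "(real \<Rightarrow> real) \<Rightarrow> real" where
  "quartic u = integral\<^sup>L circ (\<lambda>x. (u x)^4)"

lemma quartic_nonneg: "0 \<le> quartic u"
  unfolding quartic_def by (intro integral_nonneg_AE AE_I2) simp

lemma quartic_scale: "quartic (\<lambda>x. c * u x) = c^4 * quartic u"
  by (simp add: quartic_def power_mult_distrib)

context
  fixes s :: real assumes s: "1/4 < s"
begin

lemma Y_set_mass_iff: "u \<in> Y_set s \<tau> \<longleftrightarrow> u \<in> Hs_per_odd s \<and> mass u = \<tau>"
  using Y_set_iff[of s u \<tau>] s by (simp add: mass_def)

lemma energy_split:
  assumes "u \<in> Hs_per_odd s"
  shows "energy s u = kinetic s u / 2 + quartic u / 4"
  using energy_eq[OF _ assms Hs_embeds_L4[OF s assms]] s by (simp add: quartic_def)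

lemma summable_mass: "u \<in> Hs_per_odd s \<Longrightarrow> summable (\<lambda>k. (sine_coeff u k)\<^sup>2)"
  using s by (intro summable_le_sobolev_weight[of s] Hs_per_oddD(6)) auto

lemma summable_kinetic: "u \<in> Hs_per_odd s \<Longrightarrow> summable (\<lambda>k. real k powr (2 * s) * (sine_coeff u k)\<^sup>2)"
  using s by (intro Hs_kinetic_summable Hs_per_oddD(6)) auto

lemma mass_eq: "u \<in> Hs_per_odd s \<Longrightarrow> mass u = integral\<^sup>L circ (\<lambda>x. (u x)\<^sup>2)"
  unfolding mass_def by (rule Parseval_sine[symmetric]) (auto intro: summable_mass Hs_per_oddD)

lemma mass_nonneg: "u \<in> Hs_per_odd s \<Longrightarrow> 0 \<le> mass u"
  by (simp add: mass_eq)

lemma kinetic_nonneg: "u \<in> Hs_per_odd s \<Longrightarrow> 0 \<le> kinetic s u"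
  unfolding kinetic_def by (intro mult_nonneg_nonneg suminf_nonneg summable_kinetic) auto

lemma mass_scale: "u \<in> Hs_per_odd s \<Longrightarrow> mass (\<lambda>x. c * u x) = c\<^sup>2 * mass u"
  by (simp add: mass_def sine_coeff_scale power_mult_distrib suminf_mult summable_mass)

lemma kinetic_scale: "u \<in> Hs_per_odd s \<Longrightarrow> kinetic s (\<lambda>x. c * u x) = c\<^sup>2 * kinetic s u"
  using suminf_mult[OF summable_kinetic, of u "c\<^sup>2"]
  by (simp add: kinetic_def sine_coeff_scale power_mult_distrib mult_ac)

lemma normalize_in_Y_set:
  assumes u: "u \<in> Hs_per_odd s" and m: "0 < mass u" and \<tau>: "0 < \<tau>"
  shows "(\<lambda>x. sqrt (\<tau> / mass u) * u x) \<in> Y_set s \<tau>"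
  unfolding Y_set_mass_iff using Hs_per_odd_scale[OF u] mass_scale[OF u] m \<tau> by simp

lemma Y_set_nonempty:
  assumes "0 < \<tau>"
  shows "Y_set s \<tau> \<noteq> {}"
proof -
  have "(\<lambda>x. sin (real 1 * x)) \<in> Hs_per_odd s" by (rule sin_in_Hs_per_odd)
  moreover have "(\<lambda>k. (sine_coeff (\<lambda>x. sin (real 1 * x)) k)\<^sup>2) sums 1"
    unfolding sine_coeff_sin using sums_single[of 1 "\<lambda>_. 1::real"]
    by (rule sums_cong[THEN iffD1, rotated]) simp
  then have "mass (\<lambda>x. sin (real 1 * x)) = pi" unfolding mass_def by (simp only: sums_unique[symmetric])
  ultimately show ?thesis using normalize_in_Y_set[of "\<lambda>x. sin (real 1 * x)" \<tau>] assms by auto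
qed

text \<open>
  Fails for \<open>k = 0\<close>, which is harmless for odd functions. It turns the bound on the kinetic part
  into membership in \<open>H\<^sup>s\<close>.
\<close>

lemma sobolev_weight_le:
  assumes "k > 0"
  shows "sobolev_weight s k \<le> 2 powr s * real k powr (2 * s)"
proof -
  have "1 + (real k)\<^sup>2 \<le> 2 * (real k)\<^sup>2" using assms by simp
  then have "sobolev_weight s k \<le> (2 * (real k)\<^sup>2) powr s"
    unfolding sobolev_weight_def using s by (intro powr_mono2) auto
  also have "\<dots> = 2 powr s * real k powr (2 * s)"
    by (simp add: powr_mult powr_powr[symmetric])
  finally show ?thesis .
qed

lemma sine_coeff_square_le_mass:
  assumes "u \<in> Hs_per_odd s"
  shows "(sine_coeff u k)\<^sup>2 \<le> mass u / pi"
  using sum_le_suminf[OF summable_mass[OF assms], of "{k}"] by (simp add: mass_def)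

text \<open>
  Only the limit \<open>\<Gamma>\<close> of the energies is known, so lower semicontinuity of the two parts can be added
  only if each part converges by itself. The diagonal subsequence is therefore chosen such that the
  quadratic parts converge as well, and the quartic parts follow by subtraction.
\<close>

theorem minimizer_exists:
  assumes \<tau>: "0 < \<tau>"
  shows "\<exists>\<phi>\<in>Y_set s \<tau>. \<forall>u\<in>Y_set s \<tau>. energy s \<phi> \<le> energy s u"
proof -
  define \<Gamma> where "\<Gamma> = (INF u\<in>Y_set s \<tau>. energy s u)"
  have energy0: "0 \<le> energy s u" if "u \<in> Y_set s \<tau>" for u
    using that kinetic_nonneg quartic_nonneg by (simp add: Y_set_mass_iff energy_split)
  have bdd: "bdd_below (energy s ` Y_set s \<tau>)" using energy0 by (auto intro!: bdd_belowI[of _ 0])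
  have \<Gamma>_le: "\<Gamma> \<le> energy s u" if "u \<in> Y_set s \<tau>" for u
    unfolding \<Gamma>_def by (rule cINF_lower[OF bdd that])
  have "\<exists>u\<in>Y_set s \<tau>. energy s u < \<Gamma> + 1 / real (Suc n)" for n
    using cINF_less_iff[OF Y_set_nonempty[OF \<tau>] bdd, of "\<Gamma> + 1 / real (Suc n)"]
    unfolding \<Gamma>_def[symmetric] by simp
  then obtain u where uY: "\<And>n. u n \<in> Y_set s \<tau>" and uE: "\<And>n. energy s (u n) < \<Gamma> + 1 / real (Suc n)"
    by metis
  have uH: "u n \<in> Hs_per_odd s" and um: "mass (u n) = \<tau>" for n
    using uY by (auto simp: Y_set_mass_iff)
  have kin_le: "kinetic s (u n) \<le> 2 * \<Gamma> + 2" for n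
  proof -
    have "1 / real (Suc n) \<le> 1" by simp
    then show ?thesis using uE[of n] quartic_nonneg[of "u n"] energy_split[OF uH, of n] by linarith
  qed
  \<comment> \<open>The slot \<open>k = 0\<close> carries no information in the coefficients and is used for the kinetic part.\<close>
  define f where "f n k = (if k = 0 then kinetic s (u n) else sine_coeff (u n) k)" for n k :: nat
  have "norm (f n k) \<le> (2 * \<Gamma> + 2) + (1 + \<tau> / pi)" for n k
  proof -
    have "\<bar>sine_coeff (u n) k\<bar> \<le> 1 + (sine_coeff (u n) k)\<^sup>2"
      using zero_le_power2[of "\<bar>sine_coeff (u n) k\<bar> - 1"] abs_ge_zero[of "sine_coeff (u n) k"]
      unfolding power2_diff by simp
    also have "\<dots> \<le> 1 + \<tau> / pi" using sine_coeff_square_le_mass[OF uH, of n k] um by simp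
    finally have "\<bar>sine_coeff (u n) k\<bar> \<le> 1 + \<tau> / pi" .
    moreover have "\<bar>kinetic s (u n)\<bar> \<le> 2 * \<Gamma> + 2" using kin_le kinetic_nonneg[OF uH] by simp
    moreover have "0 \<le> \<tau> / pi" using \<tau> by simp
    ultimately show ?thesis unfolding f_def
      by (cases "k = 0") (simp_all del: zero_le_divide_iff)
  qed
  then obtain r :: "nat \<Rightarrow> nat" where r: "strict_mono r" and "\<And>k. k \<in> UNIV \<Longrightarrow> \<exists>l. (\<lambda>n. f (r n) k) \<longlonglongrightarrow> l"
    using function_convergent_subsequence[of UNIV f] by blast
  then obtain l where l: "\<And>k. (\<lambda>n. f (r n) k) \<longlonglongrightarrow> l k" by (metis UNIV_I)
  define v where "v n = u (r n)" for n
  define \<beta> where "\<beta> k = (if k = 0 then 0 else l k)" for k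
  have vH: "v n \<in> Hs_per_odd s" and vm: "mass (v n) = \<tau>" for n using uH um by (auto simp: v_def)
  note v = Hs_per_oddD[OF vH]
  have kin_lim: "(\<lambda>n. kinetic s (v n)) \<longlonglongrightarrow> l 0" using l[of 0] by (simp add: f_def v_def)
  have coeff_lim: "(\<lambda>n. sine_coeff (v n) k) \<longlonglongrightarrow> \<beta> k" for k
    using l[of k] by (cases "k = 0") (simp_all add: f_def v_def \<beta>_def)
  have E_lim: "(\<lambda>n. energy s (v n)) \<longlonglongrightarrow> \<Gamma>"
  proof (rule tendsto_sandwich[OF _ _ tendsto_const])
    show "\<forall>\<^sub>F n in sequentially. \<Gamma> \<le> energy s (v n)" using \<Gamma>_le uY by (simp add: v_def)
    have "energy s (v n) \<le> \<Gamma> + 1 / real (Suc n)" for n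
    proof -
      have "1 / real (Suc (r n)) \<le> 1 / real (Suc n)"
        using seq_suble[OF r, of n] by (intro divide_left_mono) auto
      then show ?thesis using uE[of "r n"] by (simp add: v_def)
    qed
    then show "\<forall>\<^sub>F n in sequentially. energy s (v n) \<le> \<Gamma> + 1 / real (Suc n)" by simp
    show "(\<lambda>n. \<Gamma> + 1 / real (Suc n)) \<longlonglongrightarrow> \<Gamma>"
      using tendsto_add[OF tendsto_const LIMSEQ_inverse_real_of_nat, of \<Gamma>] by (simp add: inverse_eq_divide)
  qed
  have Q_lim: "(\<lambda>n. quartic (v n)) \<longlonglongrightarrow> 4 * \<Gamma> - 2 * l 0"
  proof -
    have "(\<lambda>n. 4 * energy s (v n) - 2 * kinetic s (v n)) \<longlonglongrightarrow> 4 * \<Gamma> - 2 * l 0"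
      by (intro tendsto_intros E_lim kin_lim)
    then show ?thesis by (simp add: energy_split[OF vH] algebra_simps)
  qed
  have \<beta>0: "\<beta> 0 = 0" by (simp add: \<beta>_def)
  have sm: "summable (\<lambda>k. (\<beta> k)\<^sup>2)"
  proof (rule Fatou_series(1)[where c = "\<lambda>n k. (sine_coeff (v n) k)\<^sup>2" and C = "\<lambda>_. \<tau> / pi"])
    show "(\<Sum>k. (sine_coeff (v n) k)\<^sup>2) \<le> \<tau> / pi" for n
      using vm[of n] by (simp add: mass_def field_simps)
  qed (auto intro!: tendsto_intros coeff_lim summable_mass vH)
  have kin: "summable (\<lambda>k. real k powr (2 * s) * (\<beta> k)\<^sup>2)"
     "(\<Sum>k. real k powr (2 * s) * (\<beta> k)\<^sup>2) \<le> l 0 / pi"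
  proof -
    have *: "(\<Sum>k. real k powr (2 * s) * (sine_coeff (v n) k)\<^sup>2) \<le> kinetic s (v n) / pi" for n
      by (simp add: kinetic_def)
    have lim: "(\<lambda>n. kinetic s (v n) / pi) \<longlonglongrightarrow> l 0 / pi" by (intro tendsto_intros kin_lim) simp
    show "summable (\<lambda>k. real k powr (2 * s) * (\<beta> k)\<^sup>2)"
      by (rule Fatou_series(1)[OF _ _ _ * lim]) (auto intro!: tendsto_intros coeff_lim summable_kinetic vH)
    show "(\<Sum>k. real k powr (2 * s) * (\<beta> k)\<^sup>2) \<le> l 0 / pi"
      by (rule Fatou_series(2)[OF _ _ _ * lim]) (auto intro!: tendsto_intros coeff_lim summable_kinetic vH)
  qed
  obtain \<phi> where \<phi>: "periodic_2pi \<phi>" "\<And>x. \<phi> (- x) = - \<phi> x" "L2_tendsto (sine_poly \<beta>) \<phi>"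
    using Riesz_Fischer_sine[OF \<beta>0 sm] by blast
  have \<phi>_sq: "square_integrable \<phi>" using \<phi>(3) by (simp add: L2_tendsto_def)
  have \<phi>_coeff: "sine_coeff \<phi> k = \<beta> k" for k
    using L2_tendsto_sine_poly(1)[of \<beta> \<phi> k] \<beta>0 \<phi>(3) by blast
  have \<phi>H: "\<phi> \<in> Hs_per_odd s"
    unfolding Hs_per_odd_iff
  proof (intro conjI)
    have "summable (\<lambda>k. 2 powr s * (real k powr (2 * s) * (\<beta> k)\<^sup>2))" by (rule summable_mult[OF kin(1)])
    then show "summable (\<lambda>k. sobolev_weight s k * (sine_coeff \<phi> k)\<^sup>2)"
    proof (rule summable_comparison_test'[of _ 0])
      fix k
      show "norm (sobolev_weight s k * (sine_coeff \<phi> k)\<^sup>2) \<le> 2 powr s * (real k powr (2 * s) * (\<beta> k)\<^sup>2)"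
        using mult_right_mono[OF sobolev_weight_le[of k], of "(\<beta> k)\<^sup>2"] \<beta>0
        by (cases "k = 0") (simp_all add: \<phi>_coeff mult.assoc)
    qed
  qed (use \<phi> \<phi>_sq in auto)
  note \<phi>' = Hs_per_oddD[OF \<phi>H]
  have diff_coeff: "sine_coeff (\<lambda>x. v n x - \<phi> x) k = sine_coeff (v n) k + - \<beta> k" for n k
    using sine_coeff_diff[OF v(2) \<phi>_sq] by (simp add: \<phi>_coeff)
  have diffH: "(\<lambda>x. v n x - \<phi> x) \<in> Hs_per_odd s" for n
    using Hs_per_odd_add[OF vH Hs_per_odd_scale[OF \<phi>H, of "-1"]] by simp
  have L2: "L2_tendsto v \<phi>"
  proof -
    have kin_minus: "summable (\<lambda>k. real k powr (2 * s) * (- \<beta> k)\<^sup>2)" using kin(1) by simp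
    have "(\<lambda>n. \<Sum>k. (sine_coeff (\<lambda>x. v n x - \<phi> x) k)\<^sup>2) \<longlonglongrightarrow> 0"
    proof (rule l2_convergence_of_weighted_bound)
      show "0 < s" using s by simp
      show "(\<lambda>n. sine_coeff (\<lambda>x. v n x - \<phi> x) k) \<longlonglongrightarrow> 0" for k
        using tendsto_diff[OF coeff_lim tendsto_const[of "\<beta> k"], of k] by (simp add: diff_coeff)
      show "(\<Sum>k. real k powr (2 * s) * (sine_coeff (\<lambda>x. v n x - \<phi> x) k)\<^sup>2)
         \<le> 2 * ((2 * \<Gamma> + 2) / pi) + 2 * (l 0 / pi)" for n
      proof -
        have "(\<Sum>k. real k powr (2 * s) * (sine_coeff (v n) k)\<^sup>2) \<le> (2 * \<Gamma> + 2) / pi"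
          using kin_le[of "r n"] by (simp add: kinetic_def v_def field_simps)
        then show ?thesis
          using summable_weighted_square_add(2)[OF powr_ge_zero summable_kinetic[OF vH] kin_minus, of n] kin(2)
          unfolding diff_coeff power2_minus by linarith
      qed
    qed (auto intro: summable_mass summable_kinetic diffH)
    then have "(\<lambda>n. pi * (\<Sum>k. (sine_coeff (\<lambda>x. v n x - \<phi> x) k)\<^sup>2)) \<longlonglongrightarrow> 0"
      by (rule tendsto_mult_right_zero)
    then have "(\<lambda>n. integral\<^sup>L circ (\<lambda>x. (v n x - \<phi> x)\<^sup>2)) \<longlonglongrightarrow> 0"
      by (simp add: mass_eq[OF diffH, symmetric] mass_def)
    then show ?thesis using v(2) \<phi>_sq by (simp add: L2_tendsto_def)
  qed
  have "mass \<phi> = \<tau>"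
  proof -
    have "(\<lambda>n. mass (v n)) \<longlonglongrightarrow> mass \<phi>"
      using L2_tendsto_norm[OF L2] by (simp add: mass_eq[OF vH] mass_eq[OF \<phi>H])
    then show ?thesis by (simp add: vm LIMSEQ_const_iff)
  qed
  then have \<phi>Y: "\<phi> \<in> Y_set s \<tau>" using \<phi>H by (simp add: Y_set_mass_iff)
  obtain q :: "nat \<Rightarrow> nat" where q: "strict_mono q" "AE x in circ. (\<lambda>n. v (q n) x) \<longlonglongrightarrow> \<phi> x"
    using L2_tendsto_AE_subseq[OF L2] by blast
  have Q_le: "quartic \<phi> \<le> 4 * \<Gamma> - 2 * l 0"
    unfolding quartic_def
  proof (rule Fatou_integral(2)[where h = "\<lambda>n x. (v (q n) x)^4" and c = "\<lambda>n. quartic (v (q n))"])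
    show "integrable circ (\<lambda>x. (v (q n) x)^4)" for n by (rule Hs_embeds_L4[OF s vH])
    show "(\<lambda>x. (\<phi> x)^4) \<in> borel_measurable circ" using square_integrableD(2)[OF \<phi>_sq] by simp
    show "AE x in circ. (\<lambda>n. (v (q n) x)^4) \<longlonglongrightarrow> (\<phi> x)^4"
      using q(2) by eventually_elim (rule tendsto_power)
    show "(\<lambda>n. quartic (v (q n))) \<longlonglongrightarrow> 4 * \<Gamma> - 2 * l 0"
      using LIMSEQ_subseq_LIMSEQ[OF Q_lim q(1)] by (simp add: o_def)
  qed (auto simp: quartic_def)
  have "kinetic s \<phi> \<le> l 0" using kin(2) by (simp add: kinetic_def \<phi>_coeff field_simps)
  then have "energy s \<phi> \<le> \<Gamma>" using Q_le energy_split[OF \<phi>H] by simp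
  with \<phi>Y \<Gamma>_le show ?thesis by (meson order_trans)
qed

end

section \<open>The Euler--Lagrange equation\<close>

text \<open>
  The exceptional set is covered by countably many translates of its part in one period.
\<close>

lemma periodic_AE_eq:
  assumes per: "periodic_2pi f" "periodic_2pi g"
    and m: "f \<in> borel_measurable borel" "g \<in> borel_measurable borel"
    and eq: "AE x in circ. f x = g x"
  shows "AE x in lborel. f x = g x"
proof -
  interpret f: periodic_fun_simple f "2 * pi"
    using per(1) by unfold_locales (simp add: periodic_2pi_def)
  interpret g: periodic_fun_simple g "2 * pi"
    using per(2) by unfold_locales (simp add: periodic_2pi_def)
  note [measurable] = m
  define N where "N = {x \<in> {-pi..pi}. f x \<noteq> g x}"
  have "N \<in> sets lborel" unfolding N_def by measurable
  moreover have "AE x in lborel. x \<notin> N"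
    using eq unfolding AE_circ_iff by eventually_elim (auto simp: N_def)
  ultimately have N: "N \<in> null_sets lborel" by (simp add: AE_iff_null_sets)
  have U: "(\<Union>n::int. {x. x - of_int n * (2 * pi) \<in> N}) \<in> null_sets lborel"
    by (intro null_sets_UN null_sets_translation N)
  show ?thesis
  proof (rule AE_I'[OF U], clarsimp)
    fix x assume ne: "f x \<noteq> g x"
    define n where "n = \<lfloor>(x + pi) / (2 * pi)\<rfloor>"
    have "of_int n \<le> (x + pi) / (2 * pi)" "(x + pi) / (2 * pi) < of_int n + 1"
      unfolding n_def by (simp_all add: floor_less_iff)
    then have "x - of_int n * (2 * pi) \<in> {-pi..pi}"
      by (simp add: field_simps)
    moreover have "f (x - of_int n * (2 * pi)) = f x" "g (x - of_int n * (2 * pi)) = g x"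
      by (rule f.minus_of_int g.minus_of_int)+
    ultimately have "x - of_int n * (2 * pi) \<in> N" using ne by (simp add: N_def)
    then show "\<exists>n::int. x - of_int n * (2 * pi) \<in> N" by blast
  qed
qed

lemma suminf_perturb_one:
  fixes g b :: "nat \<Rightarrow> real"
  assumes "summable (\<lambda>j. g j * (b j)\<^sup>2)"
  shows "(\<Sum>j. g j * (b j + (if j = k then t else 0))\<^sup>2) =
    (\<Sum>j. g j * (b j)\<^sup>2) + g k * (2 * t * b k + t\<^sup>2)"
proof -
  have "(\<lambda>j. g j * (b j)\<^sup>2 + (if j = k then g j * (2 * t * b j + t\<^sup>2) else 0)) sums
      ((\<Sum>j. g j * (b j)\<^sup>2) + g k * (2 * t * b k + t\<^sup>2))"
    by (intro sums_add summable_sums[OF assms] sums_single)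
  moreover have "g j * (b j + (if j = k then t else 0))\<^sup>2 =
      g j * (b j)\<^sup>2 + (if j = k then g j * (2 * t * b j + t\<^sup>2) else 0)" for j
    by (simp add: power2_sum algebra_simps)
  ultimately show ?thesis by (simp add: sums_unique[symmetric])
qed

context
  fixes s :: real assumes s: "1/4 < s"
begin

text \<open>
  The minimality condition freed from the constraint: the energy of the rescaled function
  \<open>(\<tau> / m(v))\<^bsup>1/2\<^esup> v\<close>, multiplied by \<open>m(v)\<^sup>2\<close>. In this form it is polynomial in \<open>v\<close>, and it holds
  trivially if \<open>m(v) = 0\<close>.
\<close>

lemma homogeneous_energy_inequality:
  assumes \<Gamma>: "\<And>u. u \<in> Y_set s \<tau> \<Longrightarrow> \<Gamma> \<le> energy s u" and \<tau>: "0 < \<tau>" and v: "v \<in> Hs_per_odd s"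
  shows "0 \<le> \<tau> * kinetic s v * mass v / 2 + \<tau>\<^sup>2 * quartic v / 4 - \<Gamma> * (mass v)\<^sup>2"
proof (cases "mass v = 0")
  case True
  then show ?thesis using quartic_nonneg[of v] by simp
next
  case False
  then have m: "0 < mass v" using mass_nonneg[OF s v] by simp
  define c where "c = sqrt (\<tau> / mass v)"
  have c2: "c\<^sup>2 = \<tau> / mass v" using m \<tau> by (simp add: c_def)
  then have c4: "c^4 = (\<tau> / mass v)\<^sup>2" by (metis power2_eq_square power4_eq_xxxx mult.assoc)
  have "(\<lambda>x. c * v x) \<in> Y_set s \<tau>" unfolding c_def by (rule normalize_in_Y_set[OF s v m \<tau>])
  then have "\<Gamma> \<le> energy s (\<lambda>x. c * v x)" by (rule \<Gamma>)
  also have "\<dots> = c\<^sup>2 * kinetic s v / 2 + c^4 * quartic v / 4"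
    using energy_split[OF s Hs_per_odd_scale[OF v]]
    by (simp add: kinetic_scale[OF s v] quartic_scale)
  finally have "\<Gamma> * (mass v)\<^sup>2 \<le> (c\<^sup>2 * kinetic s v / 2 + c^4 * quartic v / 4) * (mass v)\<^sup>2"
    by (intro mult_right_mono) auto
  also have "\<dots> = \<tau> * kinetic s v * mass v / 2 + \<tau>\<^sup>2 * quartic v / 4"
    using m unfolding c2 c4 by (simp add: field_simps power2_eq_square)
  finally show ?thesis by simp
qed

lemma Hs_powers_integrable:
  assumes u: "u \<in> Hs_per_odd s"
  shows "square_integrable (\<lambda>x. (u x)\<^sup>2)" "integrable circ (\<lambda>x. (u x)^3)"
proof -
  note u' = Hs_per_oddD(2)[OF u]
  show sq: "square_integrable (\<lambda>x. (u x)\<^sup>2)"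
    using Hs_embeds_L4[OF s u] square_integrableD(1)[OF u']
    by (simp add: square_integrable_def flip: power_mult)
  show "integrable circ (\<lambda>x. (u x)^3)"
    using square_integrable_mult[OF sq u'] by (simp add: power2_eq_square power3_eq_cube)
qed

text \<open>
  Only the coefficient of \<open>t\<close> matters for the first variation; the higher ones merely have to exist.
\<close>

lemma quartic_perturb:
  assumes u: "u \<in> Hs_per_odd s" and e: "e \<in> borel_measurable borel" "\<And>x. \<bar>e x\<bar> \<le> 1"
  obtains q2 q3 q4 where "\<And>t. quartic (\<lambda>x. u x + t * e x) =
    quartic u + 4 * t * integral\<^sup>L circ (\<lambda>x. (u x)^3 * e x) + t^2 * q2 + t^3 * q3 + t^4 * q4"
proof -
  have ep: "(\<lambda>x. e x ^ n) \<in> borel_measurable borel" "\<bar>e x ^ n\<bar> \<le> 1" for n x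
    using e by (auto simp: power_abs power_le_one)
  have i: "integrable circ (\<lambda>x. (u x)^3 * e x)"
    "integrable circ (\<lambda>x. (u x)^2 * e x ^ 2)" "integrable circ (\<lambda>x. u x * e x ^ 3)"
    "integrable circ (\<lambda>x. e x ^ 4)"
    using integrable_circ_bounded_mult[OF Hs_powers_integrable(2)[OF u] e]
      integrable_circ_bounded_mult[OF square_integrableD(3)[OF Hs_per_oddD(2)[OF u]] ep]
      integrable_circ_bounded_mult[OF square_integrable_imp_integrable[OF Hs_per_oddD(2)[OF u]] ep]
      integrable_circ_bounded_mult[OF integrable_circ_const[of "1::real"] ep]
    by simp_all
  note i4 = Hs_embeds_L4[OF s u]
  define A1 A2 A3 A4 where "A1 x = (u x)^3 * e x" and "A2 x = (u x)^2 * e x ^ 2"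
    and "A3 x = u x * e x ^ 3" and "A4 x = e x ^ 4" for x
  have iA: "integrable circ A1" "integrable circ A2" "integrable circ A3" "integrable circ A4"
    unfolding A1_def A2_def A3_def A4_def by (fact i)+
  have "(u x + t * e x)^4 = (u x)^4 + (4 * t) * A1 x + (6 * t^2) * A2 x + (4 * t^3) * A3 x + t^4 * A4 x" for x t
    unfolding A1_def A2_def A3_def A4_def
    by (simp add: power4_eq_xxxx power3_eq_cube power2_eq_square algebra_simps)
  then have "quartic (\<lambda>x. u x + t * e x) = quartic u + 4 * t * integral\<^sup>L circ A1
     + 6 * t^2 * integral\<^sup>L circ A2 + 4 * t^3 * integral\<^sup>L circ A3 + t^4 * integral\<^sup>L circ A4" for t
    using iA i4 unfolding quartic_def by simp
  then have "quartic (\<lambda>x. u x + t * e x) = quartic u + 4 * t * integral\<^sup>L circ (\<lambda>x. (u x)^3 * e x)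
     + t^2 * (6 * integral\<^sup>L circ A2) + t^3 * (4 * integral\<^sup>L circ A3) + t^4 * integral\<^sup>L circ A4" for t
    by (simp add: A1_def[abs_def])
  then show ?thesis by (rule that)
qed

text \<open>
  First variation in the direction \<open>sin(k x)\<close>. The polynomial \<open>G\<close> is the left-hand side of the
  homogeneous inequality along \<open>\<phi> + t sin(k x)\<close>. It vanishes at \<open>t = 0\<close>, and substituting
  \<open>4 \<Gamma> = 2 K(\<phi>) + Q(\<phi>)\<close> into \<open>G'(0) = 0\<close> produces the multiplier.
\<close>

lemma Euler_Lagrange_coeff:
  assumes \<phi>: "\<phi> \<in> Y_set s \<tau>" and min: "\<And>u. u \<in> Y_set s \<tau> \<Longrightarrow> energy s \<phi> \<le> energy s u"
    and \<tau>: "0 < \<tau>"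
  shows "real k powr (2 * s) * sine_coeff \<phi> k =
    (kinetic s \<phi> + quartic \<phi>) / \<tau> * sine_coeff \<phi> k - sine_coeff (\<lambda>x. (\<phi> x)^3) k"
proof (cases "k = 0")
  case True
  then show ?thesis by simp
next
  case False
  have \<phi>H: "\<phi> \<in> Hs_per_odd s" and m: "mass \<phi> = \<tau>" using \<phi> by (auto simp: Y_set_mass_iff[OF s])
  define e where "e x = sin (real k * x)" for x
  have eH: "e \<in> Hs_per_odd s" unfolding e_def by (rule sin_in_Hs_per_odd)
  define v where "v t x = \<phi> x + t * e x" for t x
  have vH: "v t \<in> Hs_per_odd s" for t
    unfolding v_def by (intro Hs_per_odd_add \<phi>H Hs_per_odd_scale eH)
  have coeff: "sine_coeff (v t) j = sine_coeff \<phi> j + (if j = k then t else 0)" for t j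
  proof -
    have "sine_coeff e j = (if j = k then 1 else 0)"
      unfolding e_def sine_coeff_sin using False by auto
    moreover have "sine_coeff (v t) j = sine_coeff \<phi> j + t * sine_coeff e j"
      using sine_coeff_add[OF Hs_per_oddD(2)[OF \<phi>H] square_integrable_scale[OF Hs_per_oddD(2)[OF eH]], of t j]
      unfolding v_def[abs_def] sine_coeff_scale .
    ultimately show ?thesis by simp
  qed
  define b where "b = sine_coeff \<phi> k"
  define K where "K = kinetic s \<phi>"
  define q where "q = integral\<^sup>L circ (\<lambda>x. (\<phi> x)^3 * e x)"
  define w where "w = real k powr (2 * s)"
  have mass_v: "mass (v t) = \<tau> + pi * (2 * t * b + t\<^sup>2)" for t
    using suminf_perturb_one[of "\<lambda>_. 1" "sine_coeff \<phi>" k t] summable_mass[OF s \<phi>H] m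
    by (simp add: mass_def coeff b_def distrib_left)
  have kinetic_v: "kinetic s (v t) = K + pi * (w * (2 * t * b + t\<^sup>2))" for t
    using suminf_perturb_one[of "\<lambda>j. real j powr (2 * s)" "sine_coeff \<phi>" k t] summable_kinetic[OF s \<phi>H]
    by (simp add: kinetic_def coeff b_def K_def w_def distrib_left)
  obtain q2 q3 q4 where quartic_v: "\<And>t. quartic (v t) = quartic \<phi> + 4 * t * q + t^2 * q2 + t^3 * q3 + t^4 * q4"
    using quartic_perturb[OF \<phi>H, of e] unfolding v_def q_def e_def by auto
  define \<Gamma> where "\<Gamma> = energy s \<phi>"
  have \<Gamma>: "\<Gamma> = K / 2 + quartic \<phi> / 4" unfolding \<Gamma>_def K_def by (rule energy_split[OF s \<phi>H])
  define G where "G t = \<tau> * (K + pi * (w * (2 * t * b + t\<^sup>2))) * (\<tau> + pi * (2 * t * b + t\<^sup>2)) / 2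
     + \<tau>\<^sup>2 * (quartic \<phi> + 4 * t * q + t^2 * q2 + t^3 * q3 + t^4 * q4) / 4
     - \<Gamma> * (\<tau> + pi * (2 * t * b + t\<^sup>2))\<^sup>2" for t
  have G0: "G 0 = 0" by (simp add: G_def \<Gamma> field_simps power2_eq_square)
  have "0 \<le> G t" for t
    using homogeneous_energy_inequality[OF _ \<tau> vH, of \<Gamma> t] min unfolding \<Gamma>_def[symmetric]
    by (simp add: G_def mass_v kinetic_v quartic_v)
  then have G_min: "G 0 \<le> G t" for t using G0 by simp
  have "(G has_real_derivative \<tau> * (pi * (w * (2 * b))) * \<tau> / 2 + \<tau> * K * (pi * (2 * b)) / 2
     + \<tau>\<^sup>2 * (4 * q) / 4 - \<Gamma> * (2 * \<tau> * (pi * (2 * b)))) (at 0)"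
    unfolding G_def by (auto intro!: derivative_eq_intros simp: algebra_simps)
  from DERIV_local_min[OF this zero_less_one] G_min
  have "\<tau> * (pi * (w * (2 * b))) * \<tau> / 2 + \<tau> * K * (pi * (2 * b)) / 2
     + \<tau>\<^sup>2 * (4 * q) / 4 - \<Gamma> * (2 * \<tau> * (pi * (2 * b))) = 0" by blast
  then have "\<tau> * (\<tau> * pi * w * b + \<tau> * q - (K + quartic \<phi>) * pi * b) = 0"
    by (simp add: \<Gamma> algebra_simps power2_eq_square)
  then have "\<tau> * pi * w * b + \<tau> * q = (K + quartic \<phi>) * pi * b" using \<tau> by simp
  then have "w * b = (K + quartic \<phi>) / \<tau> * b - q / pi"
    using \<tau> by (simp add: field_simps)
  then show ?thesis by (simp add: w_def b_def K_def q_def sine_coeff_def e_def)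
qed

end

text \<open>
  The sum starts effectively at \<open>k = 1\<close>, where \<open>k\<^bsup>2s\<^esup> \<ge> 1\<close>.
\<close>

lemma mass_le_kinetic:
  assumes s: "1/4 < s" and u: "u \<in> Hs_per_odd s"
  shows "mass u \<le> kinetic s u"
  unfolding mass_def kinetic_def
proof (intro mult_left_mono suminf_le summable_mass[OF s u] summable_kinetic[OF s u])
  fix k
  show "(sine_coeff u k)\<^sup>2 \<le> real k powr (2 * s) * (sine_coeff u k)\<^sup>2"
  proof (cases "k = 0")
    case False
    then have "1 \<le> real k powr (2 * s)" using s by (intro ge_one_powr_ge_zero) auto
    from mult_right_mono[OF this, of "(sine_coeff u k)\<^sup>2"] show ?thesis by simp
  qed simp
qed simp

theorem proposition3p2:
  fixes s \<tau> :: real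
  assumes "1/4 < s" and "s \<le> 1" and "\<tau> > 0"
  shows "\<exists>\<phi> \<in> Y_set s \<tau>.
           energy s \<phi> = (INF u \<in> Y_set s \<tau>. energy s u) \<and>
           (\<exists>\<omega>>0. has_frac_laplacian s \<phi> (frac_laplacian s \<phi>) \<and>
              (AE x in lborel. frac_laplacian s \<phi> x - \<omega> * \<phi> x + (\<phi> x)^3 = 0))"
proof -
  note s = assms(1) and \<tau> = assms(3)
  obtain \<phi> where \<phi>: "\<phi> \<in> Y_set s \<tau>" and min: "\<And>u. u \<in> Y_set s \<tau> \<Longrightarrow> energy s \<phi> \<le> energy s u"
    using minimizer_exists[OF s \<tau>] by blast
  have inf: "energy s \<phi> = (INF u \<in> Y_set s \<tau>. energy s u)"
    using \<phi> min by (intro cInf_eq_minimum[symmetric]) auto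
  have \<phi>H: "\<phi> \<in> Hs_per_odd s" and m: "mass \<phi> = \<tau>" using \<phi> by (auto simp: Y_set_mass_iff[OF s])
  note \<phi>' = Hs_per_oddD[OF \<phi>H]
  define \<omega> where "\<omega> = (kinetic s \<phi> + quartic \<phi>) / \<tau>"
  have \<omega>: "0 < \<omega>"
    using mass_le_kinetic[OF s \<phi>H] quartic_nonneg[of \<phi>] m \<tau> by (simp add: \<omega>_def)
  define W where "W x = \<omega> * \<phi> x - (\<phi> x)^3" for x
  have i: "integrable circ \<phi>" "integrable circ (\<lambda>x. (\<phi> x)^3)"
    using square_integrable_imp_integrable[OF \<phi>'(2)] Hs_powers_integrable(2)[OF s \<phi>H] by auto
  have \<phi>m [measurable]: "\<phi> \<in> borel_measurable borel" by (rule square_integrableD(1)[OF \<phi>'(2)])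
  have per: "periodic_2pi W" using \<phi>'(1) by (simp add: periodic_2pi_def W_def)
  have odd: "odd_integrable W"
    unfolding odd_integrable_def
  proof (intro conjI)
    show "W \<in> borel_measurable borel" unfolding W_def by measurable
    show "integrable circ W" unfolding W_def using i by simp
    show "AE x in circ. W (- x) = - W x"
      using \<phi>'(4) by eventually_elim (simp add: W_def)
  qed
  have coeff: "sine_coeff W k = real k powr (2 * s) * sine_coeff \<phi> k" for k
  proof -
    have "integrable circ (\<lambda>x. \<phi> x * sin (real k * x))" "integrable circ (\<lambda>x. (\<phi> x)^3 * sin (real k * x))"
      by (rule integrable_circ_bounded_mult[OF i(1), where B=1] integrable_circ_bounded_mult[OF i(2), where B=1]; simp)+
    then have "sine_coeff W k = \<omega> * sine_coeff \<phi> k - sine_coeff (\<lambda>x. (\<phi> x)^3) k"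
      by (simp add: sine_coeff_def W_def left_diff_distrib diff_divide_distrib mult.assoc)
    then show ?thesis using Euler_Lagrange_coeff[OF s \<phi> min \<tau>, of k] by (simp add: \<omega>_def)
  qed
  have "has_frac_laplacian s \<phi> W"
    by (rule has_frac_laplacian_odd[OF \<phi>'(1) \<phi>'(5) per odd coeff])
  note fl = frac_laplacian_AE[OF this]
  have "AE x in lborel. frac_laplacian s \<phi> x = W x"
    using fl per odd by (intro periodic_AE_eq) (auto simp: has_frac_laplacian_def L1_per_iff odd_integrable_def)
  then have "AE x in lborel. frac_laplacian s \<phi> x - \<omega> * \<phi> x + (\<phi> x)^3 = 0"
    by eventually_elim (simp add: W_def)
  with \<phi> inf \<omega> fl(1) show ?thesis by blast
qed

end
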